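(* The local measurement statistics of the maximally entangled ququart state $$|\Phi_4\rangle=\frac12\sum_{j=0}^{3}|j\rangle\otimes|j\rangle\in\mathbb C^4\otimes\mathbb C^4$$ do not admit a classical simulation with any finite message dimension $d_C\in\mathbb N$.
   Context: Notation: $[n]=\{1,\dots,n\}$; $\mathbb{1}_d$ is the identity on $\mathbb C^d$; $\{|j\rangle\}$ is the computational (standard) basis. The set of $n$-outcome POVMs in dimension $d$ is $\mathcal M_{d,n}=\{(M_1,\dots,M_n): M_b=M_b^\dagger\in\mathbb C^{d\times d},\ M_b\succeq0,\ \sum_{b=1}^nM_b=\mathbb{1}_d\}$, with its Borel $\sigma$-algebra $\mathcal B(\mathcal M_{d,n})$. Definition (classical simulation of the local measurement statistics of a bipartite state). Fix $d_A,d_B,d_C\in\mathbb N$ and a state (positive semidefinite, trace one) $\rho_{AB}$ on $\mathbb C^{d_A}\otimes\mathbb C^{d_B}$. The local measurement statistics of $\rho_{AB}$ admit a classical simulation with classical message dimension $d_C$ if there exist: (1) a probability space $(\Lambda,\Sigma_\Lambda,\mu)$; (2) for every $n_A\ge1$, numbers $p_A(a,c\mid M^A,\lambda)\ge0$ for $a\in[n_A]$, $c\in[d_C]$, $M^A\in\mathcal M_{d_A,n_A}$, $\lambda\in\Lambda$, with $\sum_{a}\sum_{c}p_A(a,c\mid M^A,\lambda)=1$; and for every $n_B\ge1$, numbers $p_B(b\mid M^B,c,\lambda)\ge0$ for $b\in[n_B]$, $M^B\in\mathcal M_{d_B,n_B}$, $c\in[d_C]$, $\lambda\in\Lambda$,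 with $\sum_bp_B(b\mid M^B,c,\lambda)=1$; (3) such that all maps $(M^A,\lambda)\mapsto p_A(a,c\mid M^A,\lambda)$ are $\mathcal B(\mathcal M_{d_A,n_A})\otimes\Sigma_\Lambda$-measurable and all maps $(M^B,\lambda)\mapsto p_B(b\mid M^B,c,\lambda)$ are $\mathcal B(\mathcal M_{d_B,n_B})\otimes\Sigma_\Lambda$-measurable; (4) and such that for all $n_A,n_B\ge1$, $M^A\in\mathcal M_{d_A,n_A}$, $M^B\in\mathcal M_{d_B,n_B}$, $a\in[n_A]$, $b\in[n_B]$, $$\operatorname{tr}[\rho_{AB}(M^A_a\otimes M^B_b)]=\int_\Lambda\sum_{c=1}^{d_C}p_A(a,c\mid M^A,\lambda)\,p_B(b\mid M^B,c,\lambda)\,d\mu(\lambda).$$ A unit vector $|\psi\rangle$ stands for the state $|\psi\rangle\langle\psi|$; here $d_A=d_B=4$. *)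

theory Defs
  imports "HOL-Probability.Probability" "HOL-Library.Numeral_Type"
begin

text \<open>
  Operators on $\mathbb{C}^d$ are matrices of type \<open>complex ^ 'd ^ 'd\<close> with \<open>d = CARD('d)\<close>;
  the space $\mathbb{C}^{d_A} \otimes \mathbb{C}^{d_B}$ is \<open>complex ^ ('a \<times> 'b)\<close>, the index pair
  \<open>(i, k)\<close> standing for the product basis vector $|i\rangle \otimes |k\rangle$.
\<close>

definition cadjoint :: "complex ^ 'm ^ 'n \<Rightarrow> complex ^ 'n ^ 'm" where
  "cadjoint A = (\<chi> i j. cnj (A $ j $ i))"

definition hermitian :: "complex ^ 'n ^ 'n \<Rightarrow> bool" where
  "hermitian A \<longleftrightarrow> cadjoint A = A"

text \<open>For hermitian \<open>A\<close> the quadratic form is real, so taking \<open>Re\<close> loses nothing.\<close>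

definition psd :: "complex ^ 'n ^ 'n \<Rightarrow> bool" where
  "psd A \<longleftrightarrow> hermitian A \<and> (\<forall>v. 0 \<le> Re (\<Sum>i\<in>UNIV. cnj (v $ i) * (A *v v) $ i))"

definition state :: "complex ^ 'n ^ 'n \<Rightarrow> bool" where
  "state \<rho> \<longleftrightarrow> psd \<rho> \<and> trace \<rho> = 1"

definition tensor_vec :: "complex ^ 'a \<Rightarrow> complex ^ 'b \<Rightarrow> complex ^ ('a \<times> 'b)" where
  "tensor_vec u v = (\<chi> p. u $ fst p * v $ snd p)"

definition tensor_mat ::
  "complex ^ 'a ^ 'a \<Rightarrow> complex ^ 'b ^ 'b \<Rightarrow> complex ^ ('a \<times> 'b) ^ ('a \<times> 'b)" where
  "tensor_mat A B = (\<chi> p q. A $ fst p $ fst q * B $ snd p $ snd q)"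

definition pure_state :: "complex ^ 'n \<Rightarrow> complex ^ 'n ^ 'n" where
  "pure_state \<psi> = (\<chi> i j. \<psi> $ i * cnj (\<psi> $ j))"

text \<open>
  An \<open>n\<close>-outcome POVM is an \<open>n\<close>-tuple, represented as a function on \<open>nat\<close> that is constantly
  \<open>undefined\<close> off \<open>{1..n}\<close>.  With the product topology on \<open>nat \<Rightarrow> _\<close>, the set \<open>povms n\<close> is thus
  homeomorphic to the set of tuples.
\<close>

definition povms :: "nat \<Rightarrow> (nat \<Rightarrow> complex ^ 'd ^ 'd) set" where
  "povms n = {M \<in> {1..n} \<rightarrow>\<^sub>E {E. psd E}. (\<Sum>b=1..n. M b) = mat 1}"

definition povm_borel :: "nat \<Rightarrow> (nat \<Rightarrow> complex ^ 'd ^ 'd) measure" where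
  "povm_borel n = restrict_space borel (povms n)"

text \<open>
  \<open>pA n a c M l\<close> is $p_A(a,c \mid M,\lambda)$ for \<open>M \<in> povms n\<close>, and \<open>pB n b M c l\<close> is
  $p_B(b \mid M,c,\lambda)$.
\<close>

definition classical_simulation ::
  "nat \<Rightarrow> complex ^ ('a::finite \<times> 'b::finite) ^ ('a \<times> 'b) \<Rightarrow> 'l measure \<Rightarrow>
   (nat \<Rightarrow> nat \<Rightarrow> nat \<Rightarrow> (nat \<Rightarrow> complex ^ 'a ^ 'a) \<Rightarrow> 'l \<Rightarrow> real) \<Rightarrow>
   (nat \<Rightarrow> nat \<Rightarrow> (nat \<Rightarrow> complex ^ 'b ^ 'b) \<Rightarrow> nat \<Rightarrow> 'l \<Rightarrow> real) \<Rightarrow> bool" where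
  "classical_simulation dC \<rho> \<mu> pA pB \<longleftrightarrow>
     prob_space \<mu> \<and>
     (\<forall>n\<ge>1. \<forall>M\<in>povms n. \<forall>l\<in>space \<mu>.
        (\<forall>a\<in>{1..n}. \<forall>c\<in>{1..dC}. 0 \<le> pA n a c M l) \<and>
        (\<Sum>a=1..n. \<Sum>c=1..dC. pA n a c M l) = 1) \<and>
     (\<forall>n\<ge>1. \<forall>M\<in>povms n. \<forall>c\<in>{1..dC}. \<forall>l\<in>space \<mu>.
        (\<forall>b\<in>{1..n}. 0 \<le> pB n b M c l) \<and>
        (\<Sum>b=1..n. pB n b M c l) = 1) \<and>
     (\<forall>n\<ge>1. \<forall>a\<in>{1..n}. \<forall>c\<in>{1..dC}.
        (\<lambda>(M, l). pA n a c M l) \<in> borel_measurable (povm_borel n \<Otimes>\<^sub>M \<mu>)) \<and>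
     (\<forall>n\<ge>1. \<forall>b\<in>{1..n}. \<forall>c\<in>{1..dC}.
        (\<lambda>(M, l). pB n b M c l) \<in> borel_measurable (povm_borel n \<Otimes>\<^sub>M \<mu>)) \<and>
     (\<forall>nA\<ge>1. \<forall>nB\<ge>1. \<forall>MA\<in>povms nA. \<forall>MB\<in>povms nB. \<forall>a\<in>{1..nA}. \<forall>b\<in>{1..nB}.
        trace (\<rho> ** tensor_mat (MA a) (MB b)) =
        complex_of_real (\<integral>l. (\<Sum>c=1..dC. pA nA a c MA l * pB nB b MB c l) \<partial>\<mu>))"

text \<open>
  HOL cannot quantify existentially over types, so the type carrying the sample space is a
  parameter; a theorem denying simulability has to be stated for an arbitrary type \<open>'l\<close>.
\<close>

definition admits_classical_simulation ::
  "'l itself \<Rightarrow> nat \<Rightarrow> complex ^ ('a::finite \<times> 'b::finite) ^ ('a \<times> 'b) \<Rightarrow> bool" where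
  "admits_classical_simulation _ dC \<rho> \<longleftrightarrow>
     (\<exists>(\<mu> :: 'l measure) pA pB. classical_simulation dC \<rho> \<mu> pA pB)"

text \<open>The elements of the numeral type \<open>4\<close> are 0, 1, 2, 3.\<close>

definition Phi4 :: "complex ^ (4 \<times> 4)" where
  "Phi4 = (1/2) *s (\<Sum>j\<in>UNIV. tensor_vec (axis j 1) (axis j 1))"

lemma psd_pure_state: "psd (pure_state \<psi>)"
proof -
  have "(\<Sum>i\<in>UNIV. cnj (v $ i) * (pure_state \<psi> *v v) $ i) =
        of_real ((cmod (\<Sum>i\<in>UNIV. cnj (v $ i) * \<psi> $ i))\<^sup>2)" for v
  proof -
    have "(\<Sum>i\<in>UNIV. cnj (v $ i) * (pure_state \<psi> *v v) $ i) =
          (\<Sum>i\<in>UNIV. cnj (v $ i) * \<psi> $ i) * cnj (\<Sum>i\<in>UNIV. cnj (v $ i) * \<psi> $ i)"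
      unfolding cnj_sum sum_product
      by (simp add: pure_state_def matrix_vector_mult_def sum_distrib_left mult_ac)
    then show ?thesis
      by (simp only: complex_norm_square)
  qed
  then show ?thesis
    by (simp add: psd_def hermitian_def cadjoint_def pure_state_def vec_eq_iff mult.commute)
qed

lemma Phi4_nth: "Phi4 $ p = (if fst p = snd p then 1/2 else 0)"
proof -
  have "(\<Sum>j\<in>UNIV. tensor_vec (axis j 1) (axis j 1)) $ p =
        (\<Sum>j\<in>(UNIV :: 4 set). if j = fst p then (if fst p = snd p then 1 else 0) else (0::complex))"
    unfolding sum_component by (intro sum.cong) (auto simp: tensor_vec_def axis_def)
  then show ?thesis
    by (simp add: Phi4_def)
qed

lemma state_Phi4: "state (pure_state Phi4)"
proof -
  have "trace (pure_state Phi4) = (\<Sum>p\<in>(UNIV :: 4 set) \<times> (UNIV :: 4 set). if fst p = snd p then 1/4 else 0)"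
    unfolding trace_def UNIV_Times_UNIV
    by (intro sum.cong) (auto simp: pure_state_def Phi4_nth)
  also have "\<dots> = (\<Sum>i\<in>(UNIV :: 4 set). \<Sum>k\<in>(UNIV :: 4 set). if i = k then 1/4 else 0)"
    unfolding sum.cartesian_product by (simp only: case_prod_unfold)
  also have "\<dots> = 1"
    by simp
  finally show ?thesis
    by (simp add: state_def psd_pure_state)
qed

end

theory Submission
  imports Defs
begin

text \<open>
  Alice measures a projector onto \<open>(z, 1, x\<^sub>1, x\<^sub>2)\<close> and Bob one onto \<open>(1, s, v\<^sub>1, v\<^sub>2)\<close>.
  Up to normalisation the two outcomes then occur jointly with probability \<open>\<bar>\<sigma>\<bar>\<^sup>2\<close>, where
  \<open>\<sigma> = z + s + v\<^sub>1 x\<^sub>1 + v\<^sub>2 x\<^sub>2\<close>. Fix the hidden variable and the message, and let \<open>S\<close>, \<open>N\<close> be the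
  bounded sets of parameters for which Alice and Bob give these outcomes with positive probability.
  Since the probability is 0 at \<open>\<sigma> = 0\<close>, almost surely the volume \<open>I(\<sigma>)\<close> of pairs in \<open>S \<times> N\<close> at
  displacement \<open>\<sigma>\<close> satisfies \<open>I(0) = 0\<close>. It follows that \<open>I(t) = o(t\<^sup>2)\<close>, with a bound
  \<open>I(t) \<le> C t\<^sup>2\<close> that does not depend on \<open>S\<close>, \<open>N\<close>; integrating over the hidden variable
  and summing over finitely many messages contradicts the quadratic growth of \<open>\<bar>\<sigma>\<bar>\<^sup>2\<close>.

  The estimate on \<open>I\<close> expresses that integration over complex hyperplanes of \<open>\<complex>\<^sup>3\<close> gains two
  derivatives in \<open>L\<^sup>2\<close>; this is where dimension four enters. Concretely, second differences of \<open>I\<close>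
  are at most a constant times \<open>t\<^sup>2 \<bar>S\<bar>\<^sup>1\<^sup>/\<^sup>2 \<bar>N\<bar>\<^sup>1\<^sup>/\<^sup>2\<close>. Because \<open>I\<close> vanishes at 0, only the points of
  \<open>N\<close> that leave \<open>N\<close> under the translation by \<open>-t\<close> contribute to \<open>I(t)\<close>, and their measure
  tends to 0 with \<open>t\<close>.
\<close>

section \<open>Gaussian integrals and Fubini on Euclidean spaces\<close>

lemma borel_measurable_fst_borel [measurable]:
  "fst \<in> borel_measurable (borel :: ('a::euclidean_space \<times> 'b::euclidean_space) measure)"
  by (intro borel_measurable_continuous_onI continuous_intros)

lemma borel_measurable_snd_borel [measurable]:
  "snd \<in> borel_measurable (borel :: ('a::euclidean_space \<times> 'b::euclidean_space) measure)"
  by (intro borel_measurable_continuous_onI continuous_intros)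

lemma cis_borel [measurable]: "cis \<in> borel_measurable borel"
  by (intro borel_measurable_continuous_onI continuous_intros)

lemma cnj_borel [measurable]: "cnj \<in> borel_measurable borel"
  by (intro borel_measurable_continuous_onI continuous_intros)

lemma nn_integral_lborel_affine:
  fixes f :: "'a::euclidean_space \<Rightarrow> ennreal"
  assumes [measurable]: "f \<in> borel_measurable borel" and c: "c \<noteq> 0"
  shows "(\<integral>\<^sup>+x. f x \<partial>lborel) = \<bar>c\<bar> ^ DIM('a) * (\<integral>\<^sup>+x. f (t + c *\<^sub>R x) \<partial>lborel)"
  by (subst lborel_affine[OF c, of t])
     (simp add: nn_integral_density nn_integral_distr nn_integral_cmult ennreal_power)

lemma nn_integral_lborel_translate:
  fixes f :: "'a::euclidean_space \<Rightarrow> ennreal"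
  assumes "f \<in> borel_measurable borel"
  shows "(\<integral>\<^sup>+x. f (t + x) \<partial>lborel) = (\<integral>\<^sup>+x. f x \<partial>lborel)"
  using nn_integral_lborel_affine[OF assms, of 1 t] by simp

lemma nn_integral_lborel_reflect:
  fixes f :: "'a::euclidean_space \<Rightarrow> ennreal"
  assumes "f \<in> borel_measurable borel"
  shows "(\<integral>\<^sup>+x. f (t - x) \<partial>lborel) = (\<integral>\<^sup>+x. f x \<partial>lborel)"
  using nn_integral_lborel_affine[OF assms, of "-1" t] by simp

lemma integral_lborel_affine:
  fixes f :: "'a::euclidean_space \<Rightarrow> 'b :: {banach, second_countable_topology}"
  assumes [measurable]: "f \<in> borel_measurable borel" and c: "c \<noteq> 0"
  shows "(\<integral>x. f x \<partial>lborel) = \<bar>c\<bar> ^ DIM('a) *\<^sub>R (\<integral>x. f (t + c *\<^sub>R x) \<partial>lborel)"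
  by (subst lborel_affine[OF c, of t], subst integral_density) (auto simp: integral_distr)

lemma integral_lborel_translate:
  fixes f :: "'a::euclidean_space \<Rightarrow> 'b :: {banach, second_countable_topology}"
  assumes "f \<in> borel_measurable borel"
  shows "(\<integral>x. f (t + x) \<partial>lborel) = (\<integral>x. f x \<partial>lborel)"
  using integral_lborel_affine[OF assms, of 1 t] by simp

lemma integrable_bounded_support:
  fixes f :: "'a::euclidean_space \<Rightarrow> 'b :: {banach, second_countable_topology}"
  assumes [measurable]: "f \<in> borel_measurable borel"
    and "\<And>x. norm (f x) \<le> B" "\<And>x. norm x > R \<Longrightarrow> f x = 0"
  shows "integrable lborel f"
proof -
  have "integrable lborel (\<lambda>x::'a. indicator (cball 0 R) x *\<^sub>R B)"
    using emeasure_lborel_cball_finite[of "0::'a" R] by (intro integrable_indicator) (simp_all add: top.not_eq_extremum)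
  then show ?thesis
  proof (rule Bochner_Integration.integrable_bound)
    show "AE x in lborel. norm (f x) \<le> norm (indicator (cball 0 R) x *\<^sub>R B)"
      using assms(2,3) by (intro AE_I2) (force simp: indicator_def intro: order_trans[OF _ abs_ge_self])
  qed simp
qed

section \<open>Fourier transforms of Gaussians\<close>

lemma gaussian_fourier_real:
  fixes a \<xi> :: real
  assumes a: "0 < a"
  shows "has_bochner_integral lborel (\<lambda>x::real. of_real (exp (- (a/2) * x\<^sup>2)) * cis (x * \<xi>))
           (of_real (sqrt (2*pi/a) * exp (- \<xi>\<^sup>2 / (2*a))))"
proof -
  \<comment> \<open>The dilation by \<open>c\<close> turns the Gaussian into the standard normal
    density, whose characteristic function is known.\<close>
  define c where "c = 1 / sqrt a"
  have c: "c > 0" and c2: "c * c = 1/a" using a by (auto simp: c_def)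
  let ?f = "\<lambda>x::real. complex_of_real (exp (- (a/2) * x\<^sup>2)) * cis (x * \<xi>)"
  have eq: "?f (0 + c * x) = of_real (sqrt (2*pi)) * (std_normal_density x *\<^sub>R iexp ((c*\<xi>) * x))" for x
  proof -
    have "(c*x)\<^sup>2 = x\<^sup>2 / a" using c2 by (simp add: power2_eq_square mult_ac) (metis mult.assoc mult.left_commute times_divide_eq_left mult_1)
    then show ?thesis using a by (simp add: std_normal_density_def cis_conv_exp scaleR_conv_of_real mult_ac real_sqrt_mult)
  qed
  have int: "integrable lborel (\<lambda>x. std_normal_density x *\<^sub>R iexp ((c*\<xi>) * x))"
    by (rule Bochner_Integration.integrable_bound[OF integrable_normal_density[of 1 0]]) auto
  have "integrable lborel (\<lambda>x. ?f (0 + c * x))"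
    unfolding eq using int by (intro integrable_mult_right) auto
  then have i1: "integrable lborel ?f"
    using lborel_integrable_real_affine_iff[of c ?f 0] c by simp
  have ch: "(\<integral>x. std_normal_density x *\<^sub>R iexp ((c*\<xi>) * x) \<partial>lborel) = of_real (exp (- ((c*\<xi>)^2) / 2))"
    using fun_cong[OF char_std_normal_distribution, of "c*\<xi>"]
    by (simp add: char_def integral_density)
  have "(\<integral>x. ?f x \<partial>lborel) = \<bar>c\<bar> *\<^sub>R (\<integral>x. ?f (0 + c * x) \<partial>lborel)"
    using c by (intro lborel_integral_real_affine) auto
  also have "\<dots> = c *\<^sub>R (of_real (sqrt (2*pi)) * of_real (exp (- ((c*\<xi>)^2) / 2)))"
    unfolding eq integral_mult_right_zero ch using c by simp
  also have "(c*\<xi>)^2 = \<xi>\<^sup>2/a" using c2 by (simp add: power2_eq_square mult_ac)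
  finally have "(\<integral>x. ?f x \<partial>lborel) = of_real (sqrt (2*pi/a) * exp (- \<xi>\<^sup>2 / (2*a)))"
    using a by (simp add: c_def real_sqrt_divide scaleR_conv_of_real mult_ac)
  with i1 show ?thesis by (simp add: has_bochner_integral_iff)
qed

text \<open>Lebesgue measure on a Euclidean space is the image of the product of one-dimensional
  Lebesgue measures over \<open>Basis\<close>, so this is Fubini for a product of one-variable
  factors.\<close>

lemma has_bochner_integral_lborel_prod:
  fixes f :: "'a::euclidean_space \<Rightarrow> real \<Rightarrow> 'b::{real_normed_field,banach,second_countable_topology}"
  assumes "\<And>b. b \<in> Basis \<Longrightarrow> has_bochner_integral lborel (f b) (I b)"
  shows "has_bochner_integral lborel (\<lambda>x. \<Prod>b\<in>Basis. f b (x \<bullet> b)) (\<Prod>b\<in>Basis. I b)"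
proof -
  interpret product_sigma_finite "\<lambda>_::'a. lborel :: real measure" ..
  have i: "\<And>b. b \<in> Basis \<Longrightarrow> integrable lborel (f b)" "\<And>b. b \<in> Basis \<Longrightarrow> integral\<^sup>L lborel (f b) = I b"
    using assms by (auto simp: has_bochner_integral_iff)
  have [measurable]: "\<And>b. b \<in> Basis \<Longrightarrow> f b \<in> borel_measurable borel"
    using i(1) by (metis borel_measurable_integrable measurable_lborel2)
  have "has_bochner_integral (\<Pi>\<^sub>M b\<in>(Basis::'a set). lborel) (\<lambda>x. \<Prod>b\<in>Basis. f b (x b)) (\<Prod>b\<in>Basis. I b)"
    using product_integrable_prod[of Basis f] product_integral_prod[of Basis f] i
    by (simp add: has_bochner_integral_iff)
  then show ?thesis
    unfolding has_bochner_integral_iff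
    by (subst (1 2) lborel_eq) (simp add: integrable_distr_eq integral_distr  cong: prod.cong)
qed

text \<open>Both \<open>(norm x)\<^sup>2\<close> and \<open>x \<bullet> \<xi>\<close> are sums over
  \<open>Basis\<close>, so the integrand is a product of one-dimensional ones.\<close>

lemma gaussian_fourier:
  fixes \<xi> :: "'a::euclidean_space"
  assumes a: "0 < a"
  shows "has_bochner_integral lborel (\<lambda>x::'a. of_real (exp (- (a/2) * (norm x)\<^sup>2)) * cis (x \<bullet> \<xi>))
           (of_real (sqrt (2*pi/a) ^ DIM('a) * exp (- (norm \<xi>)\<^sup>2 / (2*a))))"
proof -
  have n: "(norm x)\<^sup>2 = (\<Sum>b\<in>Basis. (x \<bullet> b)\<^sup>2)" for x :: 'a
    by (simp add: norm_eq_sqrt_inner euclidean_inner[of x x] power2_eq_square sum_nonneg)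
  have s: "cis (\<Sum>b\<in>A. g b) = (\<Prod>b\<in>A. cis (g b))" if "finite A" for A :: "'a set" and g
    using that by induction (auto simp: cis_mult[symmetric])
  have "has_bochner_integral lborel (\<lambda>x::'a. \<Prod>b\<in>Basis. of_real (exp (- (a/2) * (x \<bullet> b)\<^sup>2)) * cis ((x \<bullet> b) * (\<xi> \<bullet> b)))
      (\<Prod>b\<in>Basis. of_real (sqrt (2*pi/a) * exp (- (\<xi> \<bullet> b)\<^sup>2 / (2*a))))"
    by (intro has_bochner_integral_lborel_prod gaussian_fourier_real a)
  then show ?thesis
    by (simp add: n prod.distrib euclidean_inner[of _ \<xi>] s exp_sum sum_distrib_left
        sum_negf[symmetric] sum_divide_distrib)
qed

text \<open>Regularity gives a compact \<open>K \<subseteq> N\<close> and an open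
  \<open>U \<supseteq> N\<close>, both close to \<open>N\<close> in measure. If \<open>h\<close> is
  shorter than the distance from \<open>K\<close> to the complement of \<open>U\<close>, a point of
  \<open>N\<close> whose translate leaves \<open>N\<close> lies outside \<open>K\<close> or has its
  translate in \<open>U - N\<close>.\<close>

lemma emeasure_Diff_translate_small:
  fixes N :: "'a::euclidean_space set"
  assumes [measurable]: "N \<in> sets borel" and "bounded N" "0 < e"
  obtains d where "0 < d" "\<And>h. norm h < d \<Longrightarrow> emeasure lborel (N - {x. x - h \<in> N}) < ennreal e"
proof -
  obtain U where U: "open U" "N \<subseteq> U" "emeasure lborel (U - N) < ennreal (e/3)"
    using outer_regular_lborel[of N "e/3"] assms by auto
  obtain K where K: "closed K" "K \<subseteq> N" "emeasure lebesgue (N - K) < ennreal (e/3)"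
    by (rule sets_lebesgue_inner_closed[of N "e/3"]) (use assms in simp_all)
  have [measurable]: "U \<in> sets borel" "K \<in> sets borel" using U(1) K(1) by (simp_all add: borel_open borel_closed)
  have K': "emeasure lborel (N - K) < ennreal (e/3)" using K(3) by simp
  have "compact K" using K(1,2) \<open>bounded N\<close> by (meson bounded_subset compact_eq_bounded_closed)
  moreover have closed_U: "closed (- U)" and KU: "K \<inter> - U = {}"
    using U(1,2) K(2) by auto
  ultimately obtain d where d: "d > 0" "\<And>x y. x \<in> K \<Longrightarrow> y \<notin> U \<Longrightarrow> d \<le> dist x y"
    using separate_compact_closed[of K "-U"] closed_U KU by auto
  have "emeasure lborel (N - {x. x - h \<in> N}) < ennreal e" if h: "norm h < d" for h
  proof -
    have sub: "N - {x. x - h \<in> N} \<subseteq> (N - K) \<union> {x. - h + x \<in> U - N}"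
    proof
      fix x assume x: "x \<in> N - {x. x - h \<in> N}"
      have "x - h \<in> U" if "x \<in> K"
        using d(2)[of x "x - h"] that h by (force simp: dist_norm)
      then show "x \<in> (N - K) \<union> {x. - h + x \<in> U - N}"
        using x by auto
    qed
    have [measurable]: "{x. - h + x \<in> U - N} \<in> sets borel"
      by measurable
    have "emeasure lborel {x. - h + x \<in> U - N} = (\<integral>\<^sup>+x. indicator (U - N) (- h + x) \<partial>lborel)"
      by (subst nn_integral_indicator[symmetric], simp) (simp only: indicator_def[abs_def] mem_Collect_eq)
    also have "\<dots> = emeasure lborel (U - N)"
      by (subst nn_integral_lborel_translate) auto
    finally have "emeasure lborel (N - {x. x - h \<in> N}) \<le> emeasure lborel (N - K) + emeasure lborel (U - N)"
      using emeasure_mono[OF sub, of lborel] emeasure_subadditive[of "N - K" lborel "{x. - h + x \<in> U - N}"]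
      by simp
    also have "\<dots> \<le> ennreal (e/3) + ennreal (e/3)"
      using K' U(3) by (intro add_mono less_imp_le)
    also have "\<dots> = ennreal (e/3 + e/3)" using \<open>0 < e\<close> by (subst ennreal_plus) auto
    also have "\<dots> < ennreal e" using \<open>0 < e\<close> by (intro ennreal_lessI) auto
    finally show ?thesis .
  qed
  with d(1) that show ?thesis by blast
qed

section \<open>A Bessel inequality for damped Fourier integrals\<close>

lemma has_bochner_integral_pair_mult:
  fixes f :: "'a::euclidean_space \<Rightarrow> complex" and g :: "'b::euclidean_space \<Rightarrow> complex"
  assumes f: "integrable lborel f" and g: "integrable lborel g"
  shows "has_bochner_integral (lborel \<Otimes>\<^sub>M lborel) (\<lambda>z. f (fst z) * g (snd z))
    (integral\<^sup>L lborel f * integral\<^sup>L lborel g)"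
proof -
  have [measurable]: "f \<in> borel_measurable borel" "g \<in> borel_measurable borel"
    using borel_measurable_integrable[OF f] borel_measurable_integrable[OF g] by simp_all
  have i: "integrable (lborel \<Otimes>\<^sub>M lborel) (\<lambda>z. f (fst z) * g (snd z))"
  proof (rule lborel_pair.Fubini_integrable)
    show "integrable lborel (\<lambda>x. \<integral>y. norm (f (fst (x, y)) * g (snd (x, y))) \<partial>lborel)"
      using f g by (simp add: norm_mult integrable_norm)
    show "AE x in lborel. integrable lborel (\<lambda>y. f (fst (x, y)) * g (snd (x, y)))"
      using g by simp
  qed simp
  show ?thesis
    using lborel_pair.integral_fst'[OF i] i by (simp add: has_bochner_integral_iff)
qed

text \<open>
  Schur test for the \<open>T T\<^sup>*\<close> kernel, which is an explicit Gaussian. The constant does not depend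
  on \<open>a\<close>, so the damping can be removed afterwards by letting \<open>a\<close> tend to 0.
\<close>

lemma gaussian_fourier_bessel:
  fixes u :: "'a::euclidean_space \<Rightarrow> complex" and L :: "'a \<Rightarrow> 'a"
  assumes L: "linear L" "\<And>q. norm (L q) = l * norm q" and l: "0 < l" and a: "0 < a"
    and u: "integrable lborel u"
  shows "(\<integral>\<^sup>+p. ennreal (exp (- (a/2) * (norm p)\<^sup>2) * (cmod (\<integral>q. u q * cis (p \<bullet> L q) \<partial>lborel))\<^sup>2) \<partial>lborel)
    \<le> ennreal ((2 * pi / l) ^ DIM('a)) * (\<integral>\<^sup>+q. ennreal ((cmod (u q))\<^sup>2) \<partial>lborel)"
proof -
  define w where "w p = exp (- (a/2) * (norm p)\<^sup>2)" for p :: 'a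
  \<comment> \<open>\<open>K (q - q')\<close> is the Fourier transform of the weight
    \<open>w\<close> at \<open>L (q - q')\<close>; only the norm of \<open>q - q'\<close> enters
    because \<open>L\<close> is a similarity.\<close>
  define K where "K d = sqrt (2*pi/a) ^ DIM('a) * exp (- (l * norm d)\<^sup>2 / (2*a))" for d :: 'a
  define U where "U p = (\<integral>q. u q * cis (p \<bullet> L q) \<partial>lborel)" for p :: 'a
  define v where "v z = u (fst z) * cnj (u (snd z))" for z
  let ?P = "lborel \<Otimes>\<^sub>M lborel :: ('a \<times> 'a) measure"
  have um [measurable]: "u \<in> borel_measurable borel"
    using borel_measurable_integrable[OF u] by simp
  have [measurable]: "L \<in> borel_measurable borel"
    by (rule borel_measurable_continuous_onI) (simp add: L(1) linear_continuous_on linear_linear)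
  have wm [measurable]: "w \<in> borel_measurable borel" and Km [measurable]: "K \<in> borel_measurable borel"
    unfolding w_def K_def by measurable
  have vm [measurable]: "v \<in> borel_measurable ?P" unfolding v_def by measurable
  have w0: "w p \<ge> 0" and K0: "K d \<ge> 0" for p d using a by (simp_all add: w_def K_def)
  have iv: "integrable ?P v"
    using has_bochner_integral_pair_mult[OF u, of "\<lambda>q. cnj (u q)"] u
    by (simp add: v_def[abs_def] has_bochner_integral_iff)
  have iw: "integrable lborel (\<lambda>p. complex_of_real (w p))"
    using gaussian_fourier[OF a, of "0::'a"] by (simp add: w_def has_bochner_integral_iff)
  have gK: "(\<integral>p. complex_of_real (w p) * cis (p \<bullet> L (q - q')) \<partial>lborel) = of_real (K (q - q'))" for q q'
    using gaussian_fourier[OF a, of "L (q - q')"] by (simp add: w_def K_def has_bochner_integral_iff L(2))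
  have iu: "integrable lborel (\<lambda>q. u q * cis (p \<bullet> L q))" for p
    by (rule Bochner_Integration.integrable_bound[OF u]) (auto simp: norm_mult)
  \<comment> \<open>The squared modulus becomes an integral over pairs, in which \<open>p\<close>
    occurs only in the phase and can be integrated first.\<close>
  have UU: "complex_of_real ((cmod (U p))\<^sup>2) = (\<integral>z. v z * cis (p \<bullet> L (fst z - snd z)) \<partial>?P)" for p
  proof -
    have "complex_of_real ((cmod (U p))\<^sup>2) = U p * (\<integral>q. cnj (u q * cis (p \<bullet> L q)) \<partial>lborel)"
      by (simp only: complex_norm_square U_def Bochner_Integration.integral_cnj)
    also have "\<dots> = (\<integral>z. (u (fst z) * cis (p \<bullet> L (fst z))) * cnj (u (snd z) * cis (p \<bullet> L (snd z))) \<partial>?P)"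
      unfolding U_def using has_bochner_integral_pair_mult[OF iu integrable_cnj[OF iu], of p p]
      by (simp add: has_bochner_integral_iff)
    also have "\<dots> = (\<integral>z. v z * cis (p \<bullet> L (fst z - snd z)) \<partial>?P)"
      by (intro Bochner_Integration.integral_cong refl)
        (simp add: v_def cis_cnj cis_mult linear_diff[OF L(1)] inner_diff_right mult_ac)
    finally show ?thesis .
  qed
  interpret PP: pair_sigma_finite "lborel :: 'a measure" ?P
    unfolding lborel_prod ..
  have i3: "integrable (lborel \<Otimes>\<^sub>M ?P) (\<lambda>(p, z). of_real (w p) * (v z * cis (p \<bullet> L (fst z - snd z))))"
  proof (rule PP.Fubini_integrable)
    show "integrable lborel (\<lambda>p. \<integral>z. norm (case (p, z) of (p, z) \<Rightarrow> of_real (w p) * (v z * cis (p \<bullet> L (fst z - snd z)))) \<partial>?P)"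
      using iw[THEN integrable_norm] iv by (simp add: norm_mult)
    show "AE p in lborel. integrable ?P (\<lambda>z. case (p, z) of (p, z) \<Rightarrow> of_real (w p) * (v z * cis (p \<bullet> L (fst z - snd z))))"
      by (intro AE_I2, unfold prod.case, intro integrable_mult_right Bochner_Integration.integrable_bound[OF iv])
        (auto simp: norm_mult)
  qed simp
  have Q: "(\<integral>p. complex_of_real (w p * (cmod (U p))\<^sup>2) \<partial>lborel)
      = (\<integral>z. v z * of_real (K (fst z - snd z)) \<partial>?P)" (is "?l = ?r")
  proof -
    have "?l = (\<integral>p. (\<integral>z. of_real (w p) * (v z * cis (p \<bullet> L (fst z - snd z))) \<partial>?P) \<partial>lborel)"
      by (simp only: of_real_mult UU integral_mult_right_zero)
    also have "\<dots> = (\<integral>z. (\<integral>p. of_real (w p) * (v z * cis (p \<bullet> L (fst z - snd z))) \<partial>lborel) \<partial>?P)"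
      using PP.Fubini_integral[OF i3] by simp
    also have "\<dots> = (\<integral>z. (\<integral>p. v z * (of_real (w p) * cis (p \<bullet> L (fst z - snd z))) \<partial>lborel) \<partial>?P)"
      by (simp only: mult_ac)
    also have "\<dots> = ?r"
      by (simp only: gK integral_mult_right_zero)
    finally show ?thesis .
  qed
  have iQ: "integrable lborel (\<lambda>p. w p * (cmod (U p))\<^sup>2)"
  proof -
    have "integrable lborel (\<lambda>p. \<integral>z. of_real (w p) * (v z * cis (p \<bullet> L (fst z - snd z))) \<partial>?P)"
      using PP.integrable_fst'[OF i3] by simp
    then have "integrable lborel (\<lambda>p. complex_of_real (w p * (cmod (U p))\<^sup>2))"
      by (simp only: of_real_mult UU integral_mult_right_zero)
    then show ?thesis by (simp only: complex_of_real_integrable_eq)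
  qed
  \<comment> \<open>The mass of \<open>K\<close> is the product of \<open>sqrt (2*pi/a)\<close> and
    \<open>sqrt (2*pi*a) / l\<close>, raised to the dimension; the parameter \<open>a\<close>
    cancels.\<close>
  have Kint: "(\<integral>\<^sup>+q'. ennreal (K (q - q')) \<partial>lborel) = ennreal ((2 * pi / l) ^ DIM('a))" for q
  proof -
    have "has_bochner_integral lborel (\<lambda>d::'a. complex_of_real (exp (- ((l\<^sup>2/a)/2) * (norm d)\<^sup>2)))
       (of_real (sqrt (2*pi/(l\<^sup>2/a)) ^ DIM('a)))"
      using gaussian_fourier[of "l\<^sup>2/a" "0::'a"] a l by simp
    then have b: "has_bochner_integral lborel (\<lambda>d::'a. exp (- ((l\<^sup>2/a)/2) * (norm d)\<^sup>2))
       (sqrt (2*pi/(l\<^sup>2/a)) ^ DIM('a))"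
      by (simp only: has_bochner_integral_iff complex_of_real_integrable_eq integral_complex_of_real of_real_eq_iff)
    have "sqrt (2*pi/a) * sqrt (2*pi/(l\<^sup>2/a)) = sqrt ((2*pi/l)\<^sup>2)"
      using a l by (subst real_sqrt_mult[symmetric]) (simp add: field_simps power2_eq_square)
    also have "\<dots> = 2*pi/l" using l by (subst real_sqrt_abs) simp
    finally have "has_bochner_integral lborel K ((2*pi/l) ^ DIM('a))"
      using has_bochner_integral_mult_right[OF b, of "sqrt (2*pi/a) ^ DIM('a)"]
      by (simp add: K_def[abs_def] power_mult_distrib mult.commute[of 2 a] flip: power_mult_distrib)
    then have "(\<integral>\<^sup>+q. ennreal (K q) \<partial>lborel) = ennreal ((2 * pi / l) ^ DIM('a))"
      using K0 by (auto simp: has_bochner_integral_iff nn_integral_eq_integral)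
    moreover have "(\<integral>\<^sup>+q'. ennreal (K (q - q')) \<partial>lborel) = (\<integral>\<^sup>+q. ennreal (K q) \<partial>lborel)"
      by (rule nn_integral_lborel_reflect) simp
    ultimately show ?thesis by simp
  qed
  have Ksym: "K (q - q') = K (q' - q)" for q q' by (simp add: K_def norm_minus_commute)
  let ?c = "ennreal ((2 * pi / l) ^ DIM('a))" and ?u = "\<lambda>q. ennreal ((cmod (u q))\<^sup>2 / 2)"
  have half: "(\<integral>\<^sup>+q. ?u q \<partial>lborel) + (\<integral>\<^sup>+q. ?u q \<partial>lborel) = (\<integral>\<^sup>+q. ennreal ((cmod (u q))\<^sup>2) \<partial>lborel)"
    by (subst nn_integral_add[symmetric]) (auto intro!: nn_integral_cong simp flip: ennreal_plus)
  have "(\<integral>\<^sup>+p. ennreal (w p * (cmod (U p))\<^sup>2) \<partial>lborel) = ennreal (\<integral>p. w p * (cmod (U p))\<^sup>2 \<partial>lborel)"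
    using iQ w0 by (intro nn_integral_eq_integral) auto
  also have "\<dots> \<le> ennreal (norm (\<integral>z. v z * of_real (K (fst z - snd z)) \<partial>?P))"
    unfolding Q[symmetric] integral_complex_of_real by (intro ennreal_leI) simp
  also have "\<dots> \<le> (\<integral>\<^sup>+z. ennreal (norm (v z * of_real (K (fst z - snd z)))) \<partial>?P)"
  proof (rule integral_norm_bound_ennreal, rule Bochner_Integration.integrable_bound)
    show "integrable ?P (\<lambda>z. v z * of_real (sqrt (2*pi/a) ^ DIM('a)))" using iv by simp
    show "AE z in ?P. norm (v z * of_real (K (fst z - snd z))) \<le> norm (v z * of_real (sqrt (2*pi/a) ^ DIM('a)))"
    proof (rule AE_I2)
      fix z :: "'a \<times> 'a"
      have "K (fst z - snd z) \<le> sqrt (2*pi/a) ^ DIM('a) * 1"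
        unfolding K_def using a by (intro mult_left_mono) auto
      then show "norm (v z * of_real (K (fst z - snd z))) \<le> norm (v z * of_real (sqrt (2*pi/a) ^ DIM('a)))"
        unfolding norm_mult norm_of_real using K0[of "fst z - snd z"]
        by (intro mult_left_mono) (auto intro: order_trans[OF _ abs_ge_self])
    qed
  qed simp
  \<comment> \<open>\<open>norm (v z)\<close> is at most half the sum of the two squares. As
    \<open>K\<close> is even, each half can be integrated over the other variable and contributes
    the mass of \<open>K\<close>.\<close>
  also have "\<dots> \<le> (\<integral>\<^sup>+z. ?u (fst z) * ennreal (K (fst z - snd z)) + ?u (snd z) * ennreal (K (fst z - snd z)) \<partial>?P)"
  proof (rule nn_integral_mono)
    fix z :: "'a \<times> 'a"
    have "norm (v z) \<le> (cmod (u (fst z)))\<^sup>2/2 + (cmod (u (snd z)))\<^sup>2/2"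
      using sum_squares_bound[of "cmod (u (fst z))" "cmod (u (snd z))"] by (simp add: v_def norm_mult)
    then have "norm (v z) * K (fst z - snd z) \<le> ((cmod (u (fst z)))\<^sup>2/2 + (cmod (u (snd z)))\<^sup>2/2) * K (fst z - snd z)"
      using K0 by (rule mult_right_mono)
    then show "ennreal (norm (v z * of_real (K (fst z - snd z)))) \<le> ?u (fst z) * ennreal (K (fst z - snd z)) + ?u (snd z) * ennreal (K (fst z - snd z))"
      using K0[of "fst z - snd z"]
      by (simp add: norm_mult distrib_right flip: ennreal_mult'' ennreal_plus)
  qed
  also have "\<dots> = (\<integral>\<^sup>+z. ?u (fst z) * ennreal (K (fst z - snd z)) \<partial>?P) + (\<integral>\<^sup>+z. ?u (snd z) * ennreal (K (fst z - snd z)) \<partial>?P)"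
    by (rule nn_integral_add) simp_all
  also have "(\<integral>\<^sup>+z. ?u (fst z) * ennreal (K (fst z - snd z)) \<partial>?P) = (\<integral>\<^sup>+q. ?u q \<partial>lborel) * ?c"
    by (subst lborel.nn_integral_fst[symmetric]) (simp_all add: nn_integral_cmult nn_integral_multc Kint)
  also have "(\<integral>\<^sup>+z. ?u (snd z) * ennreal (K (fst z - snd z)) \<partial>?P) = (\<integral>\<^sup>+q. ?u q \<partial>lborel) * ?c"
    by (subst lborel_pair.nn_integral_snd[symmetric])
      (simp_all add: nn_integral_cmult nn_integral_multc Kint Ksym[of "_ :: 'a"])
  finally show ?thesis
    unfolding w_def U_def half[symmetric] by (simp add: distrib_right distrib_left mult.commute)
qed

section \<open>Fubini and Tonelli for \<open>lborel\<close> on product types\<close>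

context
  fixes f :: "'a::euclidean_space \<times> 'b::euclidean_space \<Rightarrow> 'c::{banach, second_countable_topology}"
  assumes f: "integrable lborel f"
begin

lemma lborel_integral_fst: "(\<integral>p. f p \<partial>lborel) = (\<integral>x. \<integral>y. f (x, y) \<partial>lborel \<partial>lborel)"
  using lborel_pair.integral_fst'[of f] f by (simp add: lborel_prod)

lemma lborel_integral_snd: "(\<integral>p. f p \<partial>lborel) = (\<integral>y. \<integral>x. f (x, y) \<partial>lborel \<partial>lborel)"
  using lborel_pair.integral_snd[of "\<lambda>x y. f (x, y)"] f by (simp add: lborel_prod)

lemma lborel_integrable_fst: "integrable lborel (\<lambda>x. \<integral>y. f (x, y) \<partial>lborel)"
  using lborel_pair.integrable_fst'[of f] f by (simp add: lborel_prod)

lemma lborel_integrable_snd: "integrable lborel (\<lambda>y. \<integral>x. f (x, y) \<partial>lborel)"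
  using lborel_pair.integrable_snd[of "\<lambda>x y. f (x, y)"] f by (simp add: lborel_prod)

end

context
  fixes f :: "'a::euclidean_space \<times> 'b::euclidean_space \<Rightarrow> ennreal"
  assumes f: "f \<in> borel_measurable borel"
begin

lemma lborel_nn_integral_fst: "(\<integral>\<^sup>+p. f p \<partial>lborel) = (\<integral>\<^sup>+x. \<integral>\<^sup>+y. f (x, y) \<partial>lborel \<partial>lborel)"
  using lborel.nn_integral_fst[of f lborel] f by (simp add: lborel_prod)

lemma lborel_nn_integral_snd: "(\<integral>\<^sup>+p. f p \<partial>lborel) = (\<integral>\<^sup>+y. \<integral>\<^sup>+x. f (x, y) \<partial>lborel \<partial>lborel)"
  using lborel_pair.nn_integral_snd[of f] f by (simp add: lborel_prod)

lemma lborel_nn_integral_measurable_fst: "(\<lambda>x. \<integral>\<^sup>+y. f (x, y) \<partial>lborel) \<in> borel_measurable borel"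
  using lborel.borel_measurable_nn_integral_fst[of f lborel] f by (simp add: lborel_prod)

end

lemma lborel_integral_measurable_fst:
  fixes f :: "'a::euclidean_space \<times> 'b::euclidean_space \<Rightarrow> 'c::{banach, second_countable_topology}"
  assumes f: "f \<in> borel_measurable borel"
  shows "(\<lambda>x. \<integral>y. f (x, y) \<partial>lborel) \<in> borel_measurable borel"
  using lborel.borel_measurable_lebesgue_integral[of "\<lambda>x y. f (x, y)" lborel] f
  by (simp add: lborel_prod)

section \<open>Pairs of points at a given displacement\<close>

text \<open>The dot product has no conjugation because the state pairs Alice's operator with the
  transpose of Bob's.\<close>

definition bil :: "complex \<times> complex \<Rightarrow> complex \<times> complex \<Rightarrow> complex" where
  "bil v x = fst v * fst x + snd v * snd x"

lemma bil_measurable [measurable (raw)]: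
  "f \<in> borel_measurable M \<Longrightarrow> g \<in> borel_measurable M \<Longrightarrow> (\<lambda>p. bil (f p) (g p)) \<in> borel_measurable M"
  unfolding bil_def using measurable_compose[OF _ borel_measurable_fst_borel] measurable_compose[OF _ borel_measurable_snd_borel]
  by (intro borel_measurable_add borel_measurable_times) auto

lemma norm_fst_le_norm: "norm (fst p) \<le> norm p" and norm_snd_le_norm: "norm (snd p) \<le> norm p"
  by (metis norm_fst_le prod.collapse) (metis norm_snd_le prod.collapse)

lemma norm_bil_le: "norm (bil v x) \<le> 2 * norm v * norm x"
proof -
  have "norm (bil v x) \<le> norm (fst v) * norm (fst x) + norm (snd v) * norm (snd x)"
    unfolding bil_def by (metis norm_triangle_ineq norm_mult)
  also have "\<dots> \<le> norm v * norm x + norm v * norm x"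
    by (intro add_mono mult_mono) (auto simp: norm_fst_le_norm norm_snd_le_norm)
  finally show ?thesis by simp
qed

type_synonym pt = "complex \<times> (complex \<times> complex)"

text \<open>
  A point \<open>(x, (s, v))\<close> stands for the pair of \<open>(\<sigma> - s - bil v x, x) \<in> S\<close> and \<open>(s, v) \<in> E\<close>,
  that is, for a pair with displacement exactly \<open>\<sigma>\<close>.
\<close>

definition inc_ker :: "pt set \<Rightarrow> pt set \<Rightarrow> complex \<Rightarrow> (complex \<times> complex) \<times> pt \<Rightarrow> real" where
  "inc_ker S E \<sigma> p = indicator E (snd p) * indicator S (\<sigma> - fst (snd p) - bil (snd (snd p)) (fst p), fst p)"

text \<open>The volume \<open>I(\<sigma>)\<close>, with \<open>E\<close> for \<open>N\<close>. Since
  \<open>\<sigma>\<close> fixes the first coordinate of the point of \<open>S\<close>, the integral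
  runs over five complex variables only.\<close>

definition inc :: "pt set \<Rightarrow> pt set \<Rightarrow> complex \<Rightarrow> real" where
  "inc S E \<sigma> = (\<integral>p. inc_ker S E \<sigma> p \<partial>lborel)"

lemma inc_ker_nonneg: "0 \<le> inc_ker S E \<sigma> p" and inc_ker_le_1: "inc_ker S E \<sigma> p \<le> 1"
  by (auto simp: inc_ker_def indicator_def)

lemma inc_ker_measurable:
  assumes [measurable]: "S \<in> sets borel" "E \<in> sets borel"
    and [measurable]: "f \<in> borel_measurable M" "g \<in> borel_measurable M"
  shows "(\<lambda>x. inc_ker S E (f x) (g x)) \<in> borel_measurable M"
  unfolding inc_ker_def by measurable

text \<open>In the displacement \<open>z + s + bil v x\<close> all variables have norm at most
  \<open>R\<close>, and \<open>norm_bil_le\<close> bounds the last term by \<open>2 * R * R\<close>.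
  These bounds make the integrals below finite.\<close>

lemma inc_ker_support:
  assumes "S \<subseteq> cball 0 R" "E \<subseteq> cball 0 R" "inc_ker S E \<sigma> p \<noteq> 0"
  shows "norm \<sigma> \<le> 2 * R + 2 * R * R" and "norm p \<le> 2 * R" and "norm (fst p) \<le> R"
proof -
  obtain x s v where p: "p = (x, (s, v))" by (cases p) auto
  have 1: "(s, v) \<in> E" "(\<sigma> - s - bil v x, x) \<in> S" 
    using assms(3) by (auto simp: inc_ker_def p indicator_def split: if_splits)
  have n: "norm (s, v) \<le> R" "norm (\<sigma> - s - bil v x, x) \<le> R"
    using 1 assms(1,2) by auto
  have x: "norm x \<le> R" and s: "norm s \<le> R" "norm v \<le> R" and z: "norm (\<sigma> - s - bil v x) \<le> R"
    using n norm_fst_le[of s v] norm_snd_le[of v s] norm_fst_le[of "\<sigma> - s - bil v x" x] norm_snd_le[of x "\<sigma> - s - bil v x"]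
    by simp_all
  show "norm (fst p) \<le> R" using x p by simp
  show "norm p \<le> 2 * R" unfolding p using norm_Pair_le[of x "(s, v)"] x n by simp
  have R: "R \<ge> 0" using x norm_ge_zero order_trans by blast
  have "norm (bil v x) \<le> 2 * R * R"
    using norm_bil_le[of v x] mult_mono[OF s(2) x] R by auto
  moreover have "norm \<sigma> \<le> norm (\<sigma> - s - bil v x) + norm s + norm (bil v x)"
    using norm_triangle_ineq[of "\<sigma> - s - bil v x + s" "bil v x"] norm_triangle_ineq[of "\<sigma> - s - bil v x" s] by simp
  ultimately show "norm \<sigma> \<le> 2 * R + 2 * R * R" using z s by simp
qed

locale bounded_sets =
  fixes S E :: "pt set" and R :: real
  assumes S_borel [measurable]: "S \<in> sets borel" and E_borel [measurable]: "E \<in> sets borel"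
    and S_le: "S \<subseteq> cball 0 R" and E_le: "E \<subseteq> cball 0 R"
begin

lemmas [measurable (raw)] = inc_ker_measurable[OF S_borel E_borel]

lemma integrable_inc_ker: "integrable lborel (inc_ker S E \<sigma>)"
  using inc_ker_support(2)[OF S_le E_le]
  by (intro integrable_bounded_support[where B = 1 and R = "2 * R"])
    (force simp: inc_ker_nonneg inc_ker_le_1 not_le[symmetric])+

lemma integrable_inc_ker_pair: "integrable lborel (\<lambda>q. inc_ker S E (fst q) (snd q))"
proof (rule integrable_bounded_support[where B = 1 and R = "(2 * R + 2 * R * R) + 2 * R"])
  fix q :: "complex \<times> (complex \<times> complex) \<times> pt" assume "norm q > (2 * R + 2 * R * R) + 2 * R"
  then have "\<not> (norm (fst q) \<le> 2 * R + 2 * R * R \<and> norm (snd q) \<le> 2 * R)"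
    using norm_Pair_le[of "fst q" "snd q"] by auto
  then show "inc_ker S E (fst q) (snd q) = 0"
    using inc_ker_support[OF S_le E_le] by blast
qed(simp_all add: inc_ker_nonneg inc_ker_le_1)

lemma integrable_inc: "integrable lborel (inc S E)"
  using lborel_integrable_fst[OF integrable_inc_ker_pair] by (simp add: inc_def[abs_def])

lemma inc_nonneg: "0 \<le> inc S E \<sigma>"
  by (simp add: inc_def inc_ker_nonneg)

lemma inc_nn_integral: "ennreal (inc S E \<sigma>) = (\<integral>\<^sup>+p. ennreal (inc_ker S E \<sigma> p) \<partial>lborel)"
  unfolding inc_def using integrable_inc_ker by (intro nn_integral_eq_integral[symmetric]) (auto simp: inc_ker_nonneg)

section \<open>The Fourier transform of the displacement volume\<close>

definition S_hat where "S_hat \<zeta> x = (\<integral>z. indicator S (z, x) * cis (\<zeta> \<bullet> z) \<partial>lborel)"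
text \<open>The Fourier transform of \<open>E\<close> in all its variables, at a frequency for
  \<open>v\<close> that is determined by \<open>\<zeta>\<close> and \<open>x\<close> through
  \<open>\<zeta> \<bullet> bil v x\<close>. \<open>S_hat\<close> and \<open>E_hat\<close> transform
  in the first coordinate only.\<close>

definition E_twist where "E_twist \<zeta> x = (\<integral>y. indicator E y * cis (\<zeta> \<bullet> (fst y + bil (snd y) x)) \<partial>lborel)"
definition E_hat where "E_hat \<zeta> v = (\<integral>s. indicator E (s, v) * cis (\<zeta> \<bullet> s) \<partial>lborel)"

text \<open>Substitute \<open>\<sigma> = z + s + bil v x\<close>: the phase
  \<open>\<zeta> \<bullet> \<sigma>\<close> splits, and for fixed \<open>x\<close> the integral over
  \<open>z\<close> separates from the one over \<open>(s, v)\<close>.\<close>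

lemma inc_fourier: "(\<integral>\<sigma>. cis (\<zeta> \<bullet> \<sigma>) * of_real (inc S E \<sigma>) \<partial>lborel) = (\<integral>x. S_hat \<zeta> x * E_twist \<zeta> x \<partial>lborel)"
  and integrable_S_hat_E_twist: "integrable lborel (\<lambda>x. S_hat \<zeta> x * E_twist \<zeta> x)"
proof -
  let ?g = "\<lambda>q. cis (\<zeta> \<bullet> fst q) * complex_of_real (inc_ker S E (fst q) (snd q))"
  have ig: "integrable lborel ?g"
    by (rule Bochner_Integration.integrable_bound[OF integrable_inc_ker_pair])
      (auto simp: norm_mult)
  let ?h = "\<lambda>p. indicator E (snd p) * cis (\<zeta> \<bullet> (fst (snd p) + bil (snd (snd p)) (fst p))) * S_hat \<zeta> (fst p)"
  have inner: "(\<integral>\<sigma>. ?g (\<sigma>, p) \<partial>lborel) = ?h p" for p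
  proof -
    let ?c = "fst (snd p) + bil (snd (snd p)) (fst p)"
    have "(\<integral>\<sigma>. ?g (\<sigma>, p) \<partial>lborel) = (\<integral>\<sigma>. ?g (?c + \<sigma>, p) \<partial>lborel)"
      by (rule integral_lborel_translate[symmetric]) measurable
    also have "\<dots> = (\<integral>z. indicator E (snd p) * cis (\<zeta> \<bullet> ?c) * (indicator S (z, fst p) * cis (\<zeta> \<bullet> z)) \<partial>lborel)"
      by (intro Bochner_Integration.integral_cong refl)
        (auto simp: inc_ker_def indicator_def cis_mult inner_add_right algebra_simps)
    also have "\<dots> = ?h p"
      by (simp only: integral_mult_right_zero S_hat_def)
    finally show ?thesis .
  qed
  have ih: "integrable lborel ?h"
    using lborel_integrable_snd[OF ig] by (simp only: inner)
  have inner2: "(\<integral>y. ?h (x, y) \<partial>lborel) = S_hat \<zeta> x * E_twist \<zeta> x" for x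
    by (simp add: E_twist_def mult.commute)
  show "integrable lborel (\<lambda>x. S_hat \<zeta> x * E_twist \<zeta> x)"
    using lborel_integrable_fst[OF ih] by (simp only: inner2)
  have "(\<integral>\<sigma>. cis (\<zeta> \<bullet> \<sigma>) * of_real (inc S E \<sigma>) \<partial>lborel) = (\<integral>\<sigma>. \<integral>p. ?g (\<sigma>, p) \<partial>lborel \<partial>lborel)"
    by (simp add: inc_def)
  also have "\<dots> = (\<integral>p. ?h p \<partial>lborel)"
    using lborel_integral_fst[OF ig] lborel_integral_snd[OF ig] by (simp only: inner)
  also have "\<dots> = (\<integral>x. S_hat \<zeta> x * E_twist \<zeta> x \<partial>lborel)"
    using lborel_integral_fst[OF ih] by (simp only: inner2)
  finally show "(\<integral>\<sigma>. cis (\<zeta> \<bullet> \<sigma>) * of_real (inc S E \<sigma>) \<partial>lborel) = (\<integral>x. S_hat \<zeta> x * E_twist \<zeta> x \<partial>lborel)" .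
qed


lemma S_eq_0: "norm x > R \<Longrightarrow> indicator S (z, x) = (0::'b::zero_neq_one)"
  and S_eq_0': "norm z > R \<Longrightarrow> indicator S (z, x) = (0::'b::zero_neq_one)"
  and E_eq_0': "norm s > R \<Longrightarrow> indicator E (s, v) = (0::'b::zero_neq_one)"
  using S_le E_le norm_fst_le[of z x] norm_snd_le[of x z]  norm_fst_le[of s v] 
  by (force simp: indicator_def)+

lemma integrable_S_slice: "integrable lborel (\<lambda>z. indicator S (z, x) :: complex)"
  by (rule integrable_bounded_support[where B = 1 and R = R]) (simp_all add: S_eq_0', simp add: indicator_def)

lemma integrable_E_slice: "integrable lborel (\<lambda>z. indicator E (z, v) :: complex)"
  by (rule integrable_bounded_support[where B = 1 and R = R]) (simp_all add: E_eq_0', simp add: indicator_def)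

lemma integrable_E: "integrable lborel (indicator E :: pt \<Rightarrow> complex)"
  using E_le by (intro integrable_bounded_support[where B = 1 and R = R]) (auto simp: indicator_def)

lemma S_hat_measurable: "(\<lambda>p. S_hat (fst p) (snd p)) \<in> borel_measurable borel"
proof -
  have "(\<lambda>q. indicator S (snd q, snd (fst q)) * cis (fst (fst q) \<bullet> snd q)) \<in> borel_measurable borel"
    by measurable
  from lborel_integral_measurable_fst[OF this] show ?thesis
    by (simp add: S_hat_def)
qed

lemma E_twist_measurable: "(\<lambda>p. E_twist (fst p) (snd p)) \<in> borel_measurable borel"
proof -
  have "(\<lambda>q. indicator E (snd q) * cis (fst (fst q) \<bullet> (fst (snd q) + bil (snd (snd q)) (snd (fst q))))) \<in> borel_measurable borel"
    by measurable
  from lborel_integral_measurable_fst[OF this] show ?thesis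
    by (simp add: E_twist_def)
qed

lemma E_hat_measurable: "(\<lambda>p. E_hat (fst p) (snd p)) \<in> borel_measurable borel"
proof -
  have "(\<lambda>q. indicator E (snd q, snd (fst q)) * cis (fst (fst q) \<bullet> snd q)) \<in> borel_measurable borel"
    by measurable
  from lborel_integral_measurable_fst[OF this] show ?thesis
    by (simp add: E_hat_def)
qed

lemma hat_measurable_raw [measurable (raw)]:
  assumes "f \<in> borel_measurable M" "g \<in> borel_measurable M"
  shows "(\<lambda>x. S_hat (f x) (g x)) \<in> borel_measurable M" "(\<lambda>x. E_twist (f x) (g x)) \<in> borel_measurable M"
    and "f' \<in> borel_measurable M \<Longrightarrow> g' \<in> borel_measurable M \<Longrightarrow> (\<lambda>x. E_hat (f' x) (g' x)) \<in> borel_measurable M"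
  using measurable_compose[OF borel_measurable_Pair[OF assms] S_hat_measurable]
    measurable_compose[OF borel_measurable_Pair[OF assms] E_twist_measurable]
    measurable_compose[OF borel_measurable_Pair[of f' M g'] E_hat_measurable] by simp_all

text \<open>This is \<open>gaussian_fourier_bessel\<close> with \<open>L\<close> the identity of the
  real plane, hence \<open>l = 1\<close> and exponent 2; \<open>x\<close> is a parameter.\<close>

lemma bessel_S_hat:
  assumes "0 < a"
  shows "(\<integral>\<^sup>+\<zeta>. ennreal (exp (- (a/2) * (norm \<zeta>)\<^sup>2) * (cmod (S_hat \<zeta> x))\<^sup>2) \<partial>lborel)
    \<le> ennreal ((2*pi)\<^sup>2) * (\<integral>\<^sup>+z. indicator S (z, x) \<partial>lborel)"
proof -
  have "ennreal ((cmod (indicator S (z, x)))\<^sup>2) = indicator S (z, x)" for z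
    by (auto simp: indicator_def)
  then show ?thesis
    using gaussian_fourier_bessel[of "\<lambda>z. z" 1 a, OF _ _ _ assms integrable_S_slice[of x]]
    by (simp add: S_hat_def linear_ident)
qed

lemma bessel_E_hat:
  assumes "0 < a"
  shows "(\<integral>\<^sup>+\<zeta>. ennreal (exp (- (a/2) * (norm \<zeta>)\<^sup>2) * (cmod (E_hat \<zeta> v))\<^sup>2) \<partial>lborel)
    \<le> ennreal ((2*pi)\<^sup>2) * (\<integral>\<^sup>+s. indicator E (s, v) \<partial>lborel)"
proof -
  have "ennreal ((cmod (indicator E (z, v)))\<^sup>2) = indicator E (z, v)" for z
    by (auto simp: indicator_def)
  then show ?thesis
    using gaussian_fourier_bessel[of "\<lambda>z. z" 1 a, OF _ _ _ assms integrable_E_slice[of v]]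
    by (simp add: E_hat_def linear_ident)
qed

text \<open>
  For fixed \<open>\<zeta>\<close> the phase \<open>\<zeta> \<bullet> bil v x\<close> is a Fourier kernel on \<open>\<real>\<^sup>4\<close> dilated by \<open>\<bar>\<zeta>\<bar>\<close>; the resulting
  factor \<open>\<bar>\<zeta>\<bar>\<^sup>-\<^sup>4\<close> is what absorbs the square of a second difference.
\<close>

lemma bessel_E_twist:
  assumes "\<zeta> \<noteq> 0"
  shows "(\<integral>\<^sup>+x. ennreal (exp (- (norm x)\<^sup>2) * (cmod (E_twist \<zeta> x))\<^sup>2) \<partial>lborel)
    \<le> ennreal ((2*pi/norm \<zeta>)^4) * (\<integral>\<^sup>+v. ennreal ((cmod (E_hat \<zeta> v))\<^sup>2) \<partial>lborel)"
proof -
  \<comment> \<open>\<open>L\<close> is chosen so that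
    \<open>\<zeta> \<bullet> bil v x = x \<bullet> L v\<close>; the conjugates come from moving a
    complex factor across the real inner product.\<close>
  define L where "L v = (\<zeta> * cnj (fst v), \<zeta> * cnj (snd v))" for v
  have L: "linear L"
    by (rule linearI) (simp_all add: L_def algebra_simps scaleR_conv_of_real prod_eq_iff)
  have nL: "norm (L v) = norm \<zeta> * norm v" for v
    by (cases v) (simp add: L_def norm_Pair norm_mult power_mult_distrib real_sqrt_mult flip: distrib_left)
  have bil: "\<zeta> \<bullet> bil v x = x \<bullet> L v" for v x
    by (simp add: bil_def L_def inner_prod_def inner_complex_def algebra_simps)
  have iE: "integrable lborel (\<lambda>y. indicator E y * cis (\<zeta> \<bullet> fst y))"
    by (rule Bochner_Integration.integrable_bound[OF integrable_E]) (auto simp: norm_mult)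
  have iEx: "integrable lborel (\<lambda>y. indicator E y * cis (\<zeta> \<bullet> (fst y + bil (snd y) x)))" for x
    by (rule Bochner_Integration.integrable_bound[OF integrable_E]) (auto simp: norm_mult)
  have iG: "integrable lborel (E_hat \<zeta>)"
    using lborel_integrable_snd[OF iE] by (simp add: E_hat_def[abs_def])
  have E_twist: "E_twist \<zeta> x = (\<integral>v. E_hat \<zeta> v * cis (x \<bullet> L v) \<partial>lborel)" for x
  proof -
    have "E_twist \<zeta> x = (\<integral>v. \<integral>s. (indicator E (s, v) * cis (\<zeta> \<bullet> s)) * cis (x \<bullet> L v) \<partial>lborel \<partial>lborel)"
      unfolding E_twist_def lborel_integral_snd[OF iEx]
      by (simp add: inner_add_right bil cis_mult mult.assoc)
    then show ?thesis by (simp only: integral_mult_left_zero E_hat_def)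
  qed
  \<comment> \<open>The damping parameter 2 yields the weight
    \<open>exp (- (norm x)\<^sup>2)\<close>, and the real dimension is 4. The weight costs little,
    since \<open>S_hat\<close> vanishes for \<open>norm x > R\<close>.\<close>
  show ?thesis
    using gaussian_fourier_bessel[OF L nL _ _ iG, of 2] assms by (simp add: E_twist)
qed

end

section \<open>Second differences in Fourier space\<close>

lemma abs_two_cos_minus_two_le: "\<bar>2 * cos \<theta> - 2\<bar> \<le> \<theta>\<^sup>2" for \<theta> :: real
proof -
  have "\<bar>2 * cos \<theta> - 2\<bar> = 4 * (sin (\<theta>/2))\<^sup>2"
    using cos_double_sin[of "\<theta>/2"] by simp
  also have "(sin (\<theta>/2))\<^sup>2 \<le> (\<theta>/2)\<^sup>2"
    using abs_sin_x_le_abs_x[of "\<theta>/2"] by (simp only: abs_le_square_iff)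
  finally show ?thesis by (simp add: power2_eq_square)
qed

lemma weighted_am_gm:
  fixes A B c :: real
  assumes "0 < c"
  shows "A * B \<le> c * A\<^sup>2 / 2 + B\<^sup>2 / (2 * c)"
proof -
  have "0 \<le> (c * A - B)\<^sup>2 / (2 * c)" using assms by simp
  also have "\<dots> = c * A\<^sup>2 / 2 + B\<^sup>2 / (2 * c) - A * B"
    using assms by (simp add: power2_eq_square field_simps)
  finally show ?thesis by simp
qed

lemma ennreal_mult_add_mult:
  assumes "0 \<le> a" "0 \<le> b" "0 \<le> c" "0 \<le> a'" "0 \<le> b'" "0 \<le> c'"
  shows "ennreal a * (ennreal b * ennreal c) + ennreal a' * (ennreal b' * ennreal c') = ennreal (a * (b * c) + a' * (b' * c'))"
  using assms by (simp add: ennreal_mult ennreal_plus)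

context bounded_sets begin

definition gauss :: "real \<Rightarrow> complex \<Rightarrow> real" where "gauss a \<zeta> = exp (- (a/2) * (norm \<zeta>)\<^sup>2)"

definition inc_hat :: "complex \<Rightarrow> complex" where "inc_hat \<zeta> = (\<integral>\<sigma>. cis (\<zeta> \<bullet> \<sigma>) * of_real (inc S E \<sigma>) \<partial>lborel)"

lemma gauss_measurable [measurable]: "gauss a \<in> borel_measurable borel"
  unfolding gauss_def by measurable

lemma gauss_nonneg: "0 \<le> gauss a \<zeta>" by (simp add: gauss_def)

lemma integrable_gauss: "0 < a \<Longrightarrow> integrable lborel (\<lambda>\<zeta>. complex_of_real (gauss a \<zeta>))"
  using gaussian_fourier[of a "0::complex"] by (simp add: gauss_def has_bochner_integral_iff)

lemma inc_measurable [measurable]: "inc S E \<in> borel_measurable borel"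
  using borel_measurable_integrable[OF integrable_inc] by simp

lemma inc_hat_measurable [measurable]: "inc_hat \<in> borel_measurable borel"
proof -
  have "(\<lambda>q. cis (fst q \<bullet> snd q) * complex_of_real (inc S E (snd q))) \<in> borel_measurable borel"
    by measurable
  from lborel_integral_measurable_fst[OF this] show ?thesis by (simp add: inc_hat_def[abs_def])
qed

lemma norm_inc_hat_le: "norm (inc_hat \<zeta>) \<le> (\<integral>\<sigma>. inc S E \<sigma> \<partial>lborel)"
proof -
  have "norm (inc_hat \<zeta>) \<le> (\<integral>\<sigma>. norm (cis (\<zeta> \<bullet> \<sigma>) * complex_of_real (inc S E \<sigma>)) \<partial>lborel)"
    unfolding inc_hat_def by (rule integral_norm_bound)
  then show ?thesis by (simp add: norm_mult inc_nonneg)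
qed

lemma integrable_gauss_inc_hat:
  assumes "0 < a" and [measurable]: "c \<in> borel_measurable borel" and c: "\<And>\<zeta>. norm (c \<zeta>) \<le> K"
  shows "integrable lborel (\<lambda>\<zeta>. complex_of_real (gauss a \<zeta>) * c \<zeta> * inc_hat \<zeta>)"
proof (rule Bochner_Integration.integrable_bound)
  show "integrable lborel (\<lambda>\<zeta>. complex_of_real (gauss a \<zeta>) * of_real (K * (\<integral>\<sigma>. inc S E \<sigma> \<partial>lborel)))"
    using integrable_gauss[OF assms(1)] by simp
  have K: "K \<ge> 0" using c[of 0] norm_ge_zero order_trans by blast
  have "norm (c \<zeta>) * norm (inc_hat \<zeta>) \<le> K * (\<integral>\<sigma>. inc S E \<sigma> \<partial>lborel)" for \<zeta>
    using c norm_inc_hat_le K by (intro mult_mono) auto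
  then show "AE \<zeta> in lborel. norm (complex_of_real (gauss a \<zeta>) * c \<zeta> * inc_hat \<zeta>) \<le> norm (complex_of_real (gauss a \<zeta>) * of_real (K * (\<integral>\<sigma>. inc S E \<sigma> \<partial>lborel)))"
    using gauss_nonneg[of a] by (intro AE_I2) (auto simp: norm_mult mult.assoc abs_mult simp flip: abs_mult intro!: mult_left_mono order_trans[OF _ abs_ge_self])
qed measurable

text \<open>For each \<open>x\<close> this is Bessel's inequality in \<open>\<zeta>\<close>; Tonelli
  then reassembles the slices of \<open>S\<close>.\<close>

lemma energy_bound_S_hat:
  assumes "0 < a"
  shows "(\<integral>\<^sup>+\<zeta>. \<integral>\<^sup>+x. ennreal (gauss a \<zeta> * (cmod (S_hat \<zeta> x))\<^sup>2) \<partial>lborel \<partial>lborel) \<le> ennreal ((2*pi)\<^sup>2) * emeasure lborel S"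
proof -
  have "(\<integral>\<^sup>+\<zeta>. \<integral>\<^sup>+x. ennreal (gauss a \<zeta> * (cmod (S_hat \<zeta> x))\<^sup>2) \<partial>lborel \<partial>lborel)
      = (\<integral>\<^sup>+x. \<integral>\<^sup>+\<zeta>. ennreal (gauss a \<zeta> * (cmod (S_hat \<zeta> x))\<^sup>2) \<partial>lborel \<partial>lborel)"
  proof -
    have "(\<lambda>p. ennreal (gauss a (fst p) * (cmod (S_hat (fst p) (snd p)))\<^sup>2)) \<in> borel_measurable borel"
      by measurable
    from lborel_nn_integral_fst[OF this] lborel_nn_integral_snd[OF this] show ?thesis by simp
  qed
  also have "\<dots> \<le> (\<integral>\<^sup>+x. ennreal ((2*pi)\<^sup>2) * (\<integral>\<^sup>+z. indicator S (z, x) \<partial>lborel) \<partial>lborel)"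
    unfolding gauss_def by (intro nn_integral_mono bessel_S_hat assms)
  also have "\<dots> = ennreal ((2*pi)\<^sup>2) * (\<integral>\<^sup>+p. indicator S p \<partial>lborel)"
  proof -
    have m: "(indicator S :: pt \<Rightarrow> ennreal) \<in> borel_measurable borel" by measurable
    have "(\<lambda>x. \<integral>\<^sup>+z. indicator S (z, x) \<partial>lborel) \<in> borel_measurable lborel"
      using lborel_nn_integral_measurable_fst[of "\<lambda>q. indicator S (snd q, fst q) :: ennreal"] by simp
    then show ?thesis
      by (simp only: nn_integral_cmult lborel_nn_integral_snd[OF m])
  qed
  finally show ?thesis by simp
qed

text \<open>Bessel's inequality is used twice: in \<open>v\<close> for fixed \<open>\<zeta>\<close>,
  where the weight \<open>norm \<zeta> ^ 4\<close> absorbs the factor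
  \<open>(2*pi/norm \<zeta>)^4\<close>, and then in \<open>s\<close> for fixed
  \<open>v\<close>.\<close>

lemma energy_bound_E_twist:
  assumes "0 < a"
  shows "(\<integral>\<^sup>+\<zeta>. \<integral>\<^sup>+x. ennreal (gauss a \<zeta> * norm \<zeta> ^ 4 * (exp (- (norm x)\<^sup>2) * (cmod (E_twist \<zeta> x))\<^sup>2)) \<partial>lborel \<partial>lborel)
    \<le> ennreal ((2*pi)^6) * emeasure lborel E"
proof -
  have "(\<integral>\<^sup>+\<zeta>. \<integral>\<^sup>+x. ennreal (gauss a \<zeta> * norm \<zeta> ^ 4 * (exp (- (norm x)\<^sup>2) * (cmod (E_twist \<zeta> x))\<^sup>2)) \<partial>lborel \<partial>lborel)
    \<le> (\<integral>\<^sup>+\<zeta>. \<integral>\<^sup>+v. ennreal ((2*pi)^4) * ennreal (gauss a \<zeta> * (cmod (E_hat \<zeta> v))\<^sup>2) \<partial>lborel \<partial>lborel)"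
  proof (rule nn_integral_mono)
    fix \<zeta> :: complex
    have "(\<integral>\<^sup>+x. ennreal (gauss a \<zeta> * norm \<zeta> ^ 4 * (exp (- (norm x)\<^sup>2) * (cmod (E_twist \<zeta> x))\<^sup>2)) \<partial>lborel)
       = ennreal (gauss a \<zeta> * norm \<zeta> ^ 4) * (\<integral>\<^sup>+x. ennreal (exp (- (norm x)\<^sup>2) * (cmod (E_twist \<zeta> x))\<^sup>2) \<partial>lborel)"
      by (subst nn_integral_cmult[symmetric]) (simp_all add: ennreal_mult'[symmetric] gauss_nonneg)
    also have "\<dots> \<le> ennreal ((2*pi)^4 * gauss a \<zeta>) * (\<integral>\<^sup>+v. ennreal ((cmod (E_hat \<zeta> v))\<^sup>2) \<partial>lborel)"
    \<comment> \<open>At \<open>\<zeta> = 0\<close> the weight \<open>norm \<zeta> ^ 4\<close> makes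
      the left side vanish.\<close>
    proof (cases "\<zeta> = 0")
      case False
      have "ennreal (gauss a \<zeta> * norm \<zeta> ^ 4) * (\<integral>\<^sup>+x. ennreal (exp (- (norm x)\<^sup>2) * (cmod (E_twist \<zeta> x))\<^sup>2) \<partial>lborel)
        \<le> ennreal (gauss a \<zeta> * norm \<zeta> ^ 4) * (ennreal ((2*pi/norm \<zeta>)^4) * (\<integral>\<^sup>+v. ennreal ((cmod (E_hat \<zeta> v))\<^sup>2) \<partial>lborel))"
        using bessel_E_twist[OF False] by (rule mult_left_mono) simp
      also have "\<dots> = ennreal (gauss a \<zeta> * norm \<zeta> ^ 4 * (2*pi/norm \<zeta>)^4) * (\<integral>\<^sup>+v. ennreal ((cmod (E_hat \<zeta> v))\<^sup>2) \<partial>lborel)"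
        by (simp add: ennreal_mult' gauss_nonneg mult.assoc)
      also have "gauss a \<zeta> * norm \<zeta> ^ 4 * (2*pi/norm \<zeta>)^4 = (2*pi)^4 * gauss a \<zeta>"
        using False by (simp add: power_divide)
      finally show ?thesis .
    qed simp
    also have "\<dots> = (\<integral>\<^sup>+v. ennreal ((2*pi)^4) * ennreal (gauss a \<zeta> * (cmod (E_hat \<zeta> v))\<^sup>2) \<partial>lborel)"
      by (subst nn_integral_cmult[symmetric]) (simp_all add: ennreal_mult'[symmetric] gauss_nonneg mult.assoc)
    finally show "(\<integral>\<^sup>+x. ennreal (gauss a \<zeta> * norm \<zeta> ^ 4 * (exp (- (norm x)\<^sup>2) * (cmod (E_twist \<zeta> x))\<^sup>2)) \<partial>lborel)
       \<le> (\<integral>\<^sup>+v. ennreal ((2*pi)^4) * ennreal (gauss a \<zeta> * (cmod (E_hat \<zeta> v))\<^sup>2) \<partial>lborel)" .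
  qed
  also have "\<dots> = (\<integral>\<^sup>+v. \<integral>\<^sup>+\<zeta>. ennreal ((2*pi)^4) * ennreal (gauss a \<zeta> * (cmod (E_hat \<zeta> v))\<^sup>2) \<partial>lborel \<partial>lborel)"
  proof -
    have "(\<lambda>p. ennreal ((2*pi)^4) * ennreal (gauss a (fst p) * (cmod (E_hat (fst p) (snd p)))\<^sup>2)) \<in> borel_measurable borel"
      by measurable
    from lborel_nn_integral_fst[OF this] lborel_nn_integral_snd[OF this] show ?thesis by simp
  qed
  also have "\<dots> = (\<integral>\<^sup>+v. ennreal ((2*pi)^4) * (\<integral>\<^sup>+\<zeta>. ennreal (gauss a \<zeta> * (cmod (E_hat \<zeta> v))\<^sup>2) \<partial>lborel) \<partial>lborel)"
    by (intro nn_integral_cong nn_integral_cmult) measurable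
  also have "\<dots> \<le> (\<integral>\<^sup>+v. ennreal ((2*pi)^4) * (ennreal ((2*pi)\<^sup>2) * (\<integral>\<^sup>+s. indicator E (s, v) \<partial>lborel)) \<partial>lborel)"
    unfolding gauss_def by (intro nn_integral_mono mult_left_mono bessel_E_hat assms) simp
  also have "\<dots> = (\<integral>\<^sup>+v. ennreal ((2*pi)^6) * (\<integral>\<^sup>+s. indicator E (s, v) \<partial>lborel) \<partial>lborel)"
  proof -
    have "ennreal ((2*pi)^4) * ennreal ((2*pi)\<^sup>2) = ennreal ((2*pi)^6)"
      by (subst ennreal_mult'[symmetric]) (simp_all flip: power_add)
    then show ?thesis by (simp only: mult.assoc[symmetric])
  qed
  also have "\<dots> = ennreal ((2*pi)^6) * (\<integral>\<^sup>+p. indicator E p \<partial>lborel)"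
  proof -
    have m: "(indicator E :: pt \<Rightarrow> ennreal) \<in> borel_measurable borel" by measurable
    have "(\<lambda>x. \<integral>\<^sup>+z. indicator E (z, x) \<partial>lborel) \<in> borel_measurable lborel"
      using lborel_nn_integral_measurable_fst[of "\<lambda>q. indicator E (snd q, fst q) :: ennreal"] by simp
    then show ?thesis
      by (simp only: nn_integral_cmult lborel_nn_integral_snd[OF m])
  qed
  finally show ?thesis by simp
qed

lemma emeasure_S: "emeasure lborel S = ennreal (measure lborel S)"
  and emeasure_E: "emeasure lborel E = ennreal (measure lborel E)"
proof -
  have fin: "emeasure lborel A \<noteq> \<top>" if "A \<subseteq> cball 0 R" for A :: "pt set"
    using emeasure_mono[OF that, of lborel] emeasure_lborel_cball_finite[of "0::pt" R] by (auto intro: le_less_trans)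
  then show "emeasure lborel S = ennreal (measure lborel S)" "emeasure lborel E = ennreal (measure lborel E)"
    using fin[OF S_le] fin[OF E_le] by (simp_all add: emeasure_eq_ennreal_measure)
qed

text \<open>\<open>2 * cos (\<zeta> \<bullet> t) - 2\<close> is the multiplier of the second
  difference with step \<open>t\<close>, of size at most
  \<open>(norm \<zeta> * norm t)\<^sup>2\<close>. After \<open>inc_fourier\<close>, splitting the
  product by \<open>weighted_am_gm\<close> puts the square of this factor on \<open>E_twist\<close>,
  whose energy bound carries the weight \<open>norm \<zeta> ^ 4\<close>.\<close>

lemma second_difference_fourier_bound:
  assumes a: "0 < a" and k: "0 < k"
  shows "cmod (\<integral>\<zeta>. complex_of_real (gauss a \<zeta>) * of_real (2 * cos (\<zeta> \<bullet> t) - 2) * inc_hat \<zeta> \<partial>lborel)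
    \<le> (k * exp (R\<^sup>2) * (2*pi)\<^sup>2 * measure lborel S + norm t ^ 4 * (2*pi)^6 * measure lborel E / k) / 2"
proof -
  let ?c = "\<lambda>\<zeta>. complex_of_real (2 * cos (\<zeta> \<bullet> t) - 2)"
  let ?T1 = "\<lambda>\<zeta> x. ennreal (gauss a \<zeta> * (cmod (S_hat \<zeta> x))\<^sup>2)"
  let ?T2 = "\<lambda>\<zeta> x. ennreal (gauss a \<zeta> * norm \<zeta> ^ 4 * (exp (- (norm x)\<^sup>2) * (cmod (E_twist \<zeta> x))\<^sup>2))"
  \<comment> \<open>The coefficients of the two energies after the splitting;
    \<open>exp (R\<^sup>2)\<close> bounds \<open>exp ((norm x)\<^sup>2)\<close> wherever
    \<open>S_hat\<close> can be nonzero.\<close>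
  let ?d1 = "k * exp (R\<^sup>2) / 2" and ?d2 = "norm t ^ 4 / (2 * k)"
  have int: "integrable lborel (\<lambda>\<zeta>. complex_of_real (gauss a \<zeta>) * ?c \<zeta> * inc_hat \<zeta>)"
  proof (rule integrable_gauss_inc_hat[OF a])
    fix \<zeta> show "norm (?c \<zeta>) \<le> 4"
      unfolding norm_of_real using cos_le_one[of "\<zeta> \<bullet> t"] cos_ge_minus_one[of "\<zeta> \<bullet> t"] by linarith
  qed measurable
  have pw: "ennreal (norm (complex_of_real (gauss a \<zeta>) * ?c \<zeta> * inc_hat \<zeta>)) \<le> (\<integral>\<^sup>+x. ennreal ?d1 * ?T1 \<zeta> x + ennreal ?d2 * ?T2 \<zeta> x \<partial>lborel)" for \<zeta>
  proof -
    have "ennreal (norm (complex_of_real (gauss a \<zeta>) * ?c \<zeta> * inc_hat \<zeta>)) = ennreal (gauss a \<zeta> * \<bar>2 * cos (\<zeta> \<bullet> t) - 2\<bar>) * ennreal (norm (inc_hat \<zeta>))"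
      by (simp only: norm_mult norm_of_real abs_of_nonneg[OF gauss_nonneg], rule ennreal_mult') (simp add: gauss_nonneg)
    also have "\<dots> \<le> ennreal (gauss a \<zeta> * \<bar>2 * cos (\<zeta> \<bullet> t) - 2\<bar>) * (\<integral>\<^sup>+x. ennreal (norm (S_hat \<zeta> x * E_twist \<zeta> x)) \<partial>lborel)"
      unfolding inc_hat_def inc_fourier by (intro mult_left_mono integral_norm_bound_ennreal integrable_S_hat_E_twist) simp
    also have "\<dots> = (\<integral>\<^sup>+x. ennreal (gauss a \<zeta> * \<bar>2 * cos (\<zeta> \<bullet> t) - 2\<bar>) * ennreal (norm (S_hat \<zeta> x * E_twist \<zeta> x)) \<partial>lborel)"
      by (intro nn_integral_cmult[symmetric]) measurable
    also have "\<dots> \<le> (\<integral>\<^sup>+x. ennreal ?d1 * ?T1 \<zeta> x + ennreal ?d2 * ?T2 \<zeta> x \<partial>lborel)"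
    proof (rule nn_integral_mono)
      fix x :: "complex \<times> complex"
      let ?f = "cmod (S_hat \<zeta> x)" and ?h = "cmod (E_twist \<zeta> x)"
      have "\<bar>2 * cos (\<zeta> \<bullet> t) - 2\<bar> * (?f * ?h) \<le> ?d1 * ?f\<^sup>2 + ?d2 * (norm \<zeta> ^ 4 * (exp (- (norm x)\<^sup>2) * ?h\<^sup>2))"
      proof (cases "norm x > R")
        case True
        then have "S_hat \<zeta> x = 0" by (simp add: S_hat_def S_eq_0)
        then show ?thesis using k by simp
      next
        case False
        have "\<bar>\<zeta> \<bullet> t\<bar> \<le> norm \<zeta> * norm t" by (rule Cauchy_Schwarz_ineq2)
        then have "(\<zeta> \<bullet> t)\<^sup>2 \<le> (norm \<zeta> * norm t)\<^sup>2" by (rule abs_le_square_iff[THEN iffD1, OF order_trans]) simp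
        then have "\<bar>2 * cos (\<zeta> \<bullet> t) - 2\<bar> \<le> (norm \<zeta> * norm t)\<^sup>2"
          using abs_two_cos_minus_two_le order_trans by blast
        from mult_right_mono[OF this, of "?f * ?h"]
        have "\<bar>2 * cos (\<zeta> \<bullet> t) - 2\<bar> * (?f * ?h) \<le> ?f * ((norm \<zeta> * norm t)\<^sup>2 * ?h)"
          by (simp add: mult_ac)
        \<comment> \<open>The weight depends on \<open>x\<close> so that its inverse supplies the
          factor \<open>exp (- (norm x)\<^sup>2)\<close> of
          \<open>energy_bound_E_twist\<close>.\<close>
        also have "\<dots> \<le> (k * exp ((norm x)\<^sup>2)) * ?f\<^sup>2 / 2 + ((norm \<zeta> * norm t)\<^sup>2 * ?h)\<^sup>2 / (2 * (k * exp ((norm x)\<^sup>2)))"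
          using k by (intro weighted_am_gm) simp
        also have "((norm \<zeta> * norm t)\<^sup>2 * ?h)\<^sup>2 / (2 * (k * exp ((norm x)\<^sup>2))) = ?d2 * (norm \<zeta> ^ 4 * (exp (- (norm x)\<^sup>2) * ?h\<^sup>2))"
          using k by (simp add: power_mult_distrib exp_minus field_simps flip: power_mult)
        also have "(k * exp ((norm x)\<^sup>2)) * ?f\<^sup>2 / 2 \<le> ?d1 * ?f\<^sup>2"
          using k False by (auto intro!: mult_right_mono mult_left_mono power_mono)
        finally show ?thesis by simp
      qed
      then have "gauss a \<zeta> * (\<bar>2 * cos (\<zeta> \<bullet> t) - 2\<bar> * (?f * ?h)) \<le> gauss a \<zeta> * (?d1 * ?f\<^sup>2 + ?d2 * (norm \<zeta> ^ 4 * (exp (- (norm x)\<^sup>2) * ?h\<^sup>2)))"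
        by (rule mult_left_mono) (rule gauss_nonneg)
      then show "ennreal (gauss a \<zeta> * \<bar>2 * cos (\<zeta> \<bullet> t) - 2\<bar>) * ennreal (norm (S_hat \<zeta> x * E_twist \<zeta> x)) \<le> ennreal ?d1 * ?T1 \<zeta> x + ennreal ?d2 * ?T2 \<zeta> x"
        using k by (simp add: norm_mult gauss_nonneg algebra_simps flip: ennreal_mult' ennreal_plus)
    qed
    finally show ?thesis .
  qed
  have "ennreal (cmod (\<integral>\<zeta>. complex_of_real (gauss a \<zeta>) * ?c \<zeta> * inc_hat \<zeta> \<partial>lborel))
      \<le> (\<integral>\<^sup>+\<zeta>. ennreal (norm (complex_of_real (gauss a \<zeta>) * ?c \<zeta> * inc_hat \<zeta>)) \<partial>lborel)"
    by (rule integral_norm_bound_ennreal[OF int])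
  also have "\<dots> \<le> (\<integral>\<^sup>+\<zeta>. \<integral>\<^sup>+x. ennreal ?d1 * ?T1 \<zeta> x + ennreal ?d2 * ?T2 \<zeta> x \<partial>lborel \<partial>lborel)"
    by (intro nn_integral_mono pw)
  also have "\<dots> = (\<integral>\<^sup>+p. ennreal ?d1 * ?T1 (fst p) (snd p) + ennreal ?d2 * ?T2 (fst p) (snd p) \<partial>lborel)"
    by (subst lborel_nn_integral_fst) simp_all
  also have "\<dots> = ennreal ?d1 * (\<integral>\<^sup>+p. ?T1 (fst p) (snd p) \<partial>lborel) + ennreal ?d2 * (\<integral>\<^sup>+p. ?T2 (fst p) (snd p) \<partial>lborel)"
    by (simp add: nn_integral_add nn_integral_cmult)
  also have "(\<integral>\<^sup>+p. ?T1 (fst p) (snd p) \<partial>lborel) = (\<integral>\<^sup>+\<zeta>. \<integral>\<^sup>+x. ?T1 \<zeta> x \<partial>lborel \<partial>lborel)"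
    by (subst lborel_nn_integral_fst) simp_all
  also have "(\<integral>\<^sup>+p. ?T2 (fst p) (snd p) \<partial>lborel) = (\<integral>\<^sup>+\<zeta>. \<integral>\<^sup>+x. ?T2 \<zeta> x \<partial>lborel \<partial>lborel)"
    by (subst lborel_nn_integral_fst) simp_all
  also have "ennreal ?d1 * (\<integral>\<^sup>+\<zeta>. \<integral>\<^sup>+x. ?T1 \<zeta> x \<partial>lborel \<partial>lborel) + ennreal ?d2 * (\<integral>\<^sup>+\<zeta>. \<integral>\<^sup>+x. ?T2 \<zeta> x \<partial>lborel \<partial>lborel)
     \<le> ennreal ?d1 * (ennreal ((2*pi)\<^sup>2) * emeasure lborel S) + ennreal ?d2 * (ennreal ((2*pi)^6) * emeasure lborel E)"
    by (intro add_mono mult_left_mono energy_bound_S_hat energy_bound_E_twist a) simp_all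
  also have "\<dots> = ennreal (?d1 * ((2*pi)\<^sup>2 * measure lborel S) + ?d2 * ((2*pi)^6 * measure lborel E))"
    unfolding emeasure_S emeasure_E using k by (intro ennreal_mult_add_mult) auto
  finally have "cmod (\<integral>\<zeta>. complex_of_real (gauss a \<zeta>) * ?c \<zeta> * inc_hat \<zeta> \<partial>lborel)
     \<le> ?d1 * ((2*pi)\<^sup>2 * measure lborel S) + ?d2 * ((2*pi)^6 * measure lborel E)"
    using k by (subst (asm) ennreal_le_iff) auto
  also have "\<dots> = (k * exp (R\<^sup>2) * (2*pi)\<^sup>2 * measure lborel S + norm t ^ 4 * (2*pi)^6 * measure lborel E / k) / 2"
    using k by (simp add: field_simps)
  finally show ?thesis .
qed


section \<open>Removing the Gaussian damping\<close>

definition mollified :: "real \<Rightarrow> complex \<Rightarrow> real" where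
  "mollified a \<tau> = (\<integral>\<sigma>. 2*pi/a * exp (- (norm (\<sigma> - \<tau>))\<^sup>2 / (2*a)) * inc S E \<sigma> \<partial>lborel)"

text \<open>By Fubini, integrating over \<open>\<zeta>\<close> first gives the transform of a
  Gaussian. The normalisation of \<open>mollified\<close> makes this identity free of constants; its
  kernel has total mass \<open>(2*pi)\<^sup>2\<close>.\<close>

lemma mollified_fourier:
  assumes a: "0 < a"
  shows "complex_of_real (mollified a \<tau>) = (\<integral>\<zeta>. complex_of_real (gauss a \<zeta>) * cis (- (\<zeta> \<bullet> \<tau>)) * inc_hat \<zeta> \<partial>lborel)"
proof -
  let ?k = "\<lambda>q. (complex_of_real (gauss a (fst q)) * cis (fst q \<bullet> (snd q - \<tau>))) * of_real (inc S E (snd q))"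
  have i: "integrable lborel ?k"
  proof (rule Bochner_Integration.integrable_bound)
    show "integrable (lborel :: (complex \<times> complex) measure) (\<lambda>q. complex_of_real (gauss a (fst q)) * of_real (inc S E (snd q)))"
      using has_bochner_integral_pair_mult[OF integrable_gauss[OF a] integrable_inc[THEN integrable_of_real]]
      by (simp add: has_bochner_integral_iff lborel_prod)
  qed (auto simp: norm_mult)
  have g: "(\<integral>\<zeta>. complex_of_real (gauss a \<zeta>) * cis (\<zeta> \<bullet> w) \<partial>lborel) = of_real (2*pi/a * exp (- (norm w)\<^sup>2 / (2*a)))" for w
    using gaussian_fourier[OF a, of w] a by (simp add: gauss_def has_bochner_integral_iff)
  have "complex_of_real (mollified a \<tau>) = (\<integral>\<sigma>. of_real (2*pi/a * exp (- (norm (\<sigma> - \<tau>))\<^sup>2 / (2*a))) * of_real (inc S E \<sigma>) \<partial>lborel)"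
    by (simp only: mollified_def integral_complex_of_real[symmetric] of_real_mult)
  also have "\<dots> = (\<integral>\<sigma>. \<integral>\<zeta>. ?k (\<zeta>, \<sigma>) \<partial>lborel \<partial>lborel)"
    by (simp only: fst_conv snd_conv integral_mult_left_zero g)
  also have "\<dots> = (\<integral>\<zeta>. \<integral>\<sigma>. ?k (\<zeta>, \<sigma>) \<partial>lborel \<partial>lborel)"
    using lborel_integral_fst[OF i] lborel_integral_snd[OF i] by simp
  also have "\<dots> = (\<integral>\<zeta>. \<integral>\<sigma>. (complex_of_real (gauss a \<zeta>) * cis (- (\<zeta> \<bullet> \<tau>))) * (cis (\<zeta> \<bullet> \<sigma>) * of_real (inc S E \<sigma>)) \<partial>lborel \<partial>lborel)"
  proof -
    have "cis (\<zeta> \<bullet> (\<sigma> - \<tau>)) = cis (- (\<zeta> \<bullet> \<tau>)) * cis (\<zeta> \<bullet> \<sigma>)" for \<zeta> \<sigma> :: complex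
      by (simp add: cis_mult inner_diff_right)
    then show ?thesis by (simp only: fst_conv snd_conv mult.assoc)
  qed
  also have "\<dots> = (\<integral>\<zeta>. complex_of_real (gauss a \<zeta>) * cis (- (\<zeta> \<bullet> \<tau>)) * inc_hat \<zeta> \<partial>lborel)"
    by (simp only: integral_mult_right_zero inc_hat_def)
  finally show ?thesis .
qed

lemma mollified_second_difference:
  assumes a: "0 < a" and k: "0 < k"
  shows "mollified a t + mollified a (- t) - 2 * mollified a 0
    \<le> (k * exp (R\<^sup>2) * (2*pi)\<^sup>2 * measure lborel S + norm t ^ 4 * (2*pi)^6 * measure lborel E / k) / 2"
proof -
  have i: "integrable lborel (\<lambda>\<zeta>. complex_of_real (gauss a \<zeta>) * cis (- (\<zeta> \<bullet> \<tau>)) * inc_hat \<zeta>)" for \<tau>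
    by (rule integrable_gauss_inc_hat[OF a, where K = 1]) auto
  have "complex_of_real (mollified a t + mollified a (- t) - 2 * mollified a 0)
      = (\<integral>\<zeta>. complex_of_real (gauss a \<zeta>) * cis (- (\<zeta> \<bullet> t)) * inc_hat \<zeta> + complex_of_real (gauss a \<zeta>) * cis (- (\<zeta> \<bullet> (- t))) * inc_hat \<zeta>
          - 2 * (complex_of_real (gauss a \<zeta>) * cis (- (\<zeta> \<bullet> 0)) * inc_hat \<zeta>) \<partial>lborel)"
    using i[of t] i[of "- t"] i[of 0] by (simp add: mollified_fourier[OF a] del: cis_zero)
  \<comment> \<open>The phases at \<open>t\<close>, \<open>- t\<close> and 0 combine to
    \<open>cis (- \<theta>) + cis \<theta> - 2 = 2 * cos \<theta> - 2\<close> with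
    \<open>\<theta> = \<zeta> \<bullet> t\<close>.\<close>
  also have "\<dots> = (\<integral>\<zeta>. complex_of_real (gauss a \<zeta>) * of_real (2 * cos (\<zeta> \<bullet> t) - 2) * inc_hat \<zeta> \<partial>lborel)"
    by (intro Bochner_Integration.integral_cong refl) (simp add: complex_eq_iff algebra_simps)
  finally have eq: "complex_of_real (mollified a t + mollified a (- t) - 2 * mollified a 0) = \<dots>" .
  have "mollified a t + mollified a (- t) - 2 * mollified a 0 \<le> norm (complex_of_real (mollified a t + mollified a (- t) - 2 * mollified a 0))"
    unfolding norm_of_real by simp
  then show ?thesis
    unfolding eq using second_difference_fourier_bound[OF a k, of t] by simp
qed

lemma inc_bounded: "inc S E \<sigma> \<le> measure lborel (cball (0 :: (complex \<times> complex) \<times> pt) (2 * R))"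
proof -
  have fin: "emeasure lborel (cball (0 :: (complex \<times> complex) \<times> pt) (2 * R)) < \<infinity>"
    by (rule emeasure_lborel_cball_finite)
  have "inc S E \<sigma> \<le> (\<integral>p. indicator (cball (0 :: (complex \<times> complex) \<times> pt) (2 * R)) p \<partial>lborel)"
    unfolding inc_def
  proof (intro integral_mono integrable_inc_ker)
    show "integrable lborel (indicator (cball (0 :: (complex \<times> complex) \<times> pt) (2 * R)) :: _ \<Rightarrow> real)"
      using fin by simp
    show "inc_ker S E \<sigma> p \<le> indicator (cball 0 (2 * R)) p" for p
      using inc_ker_support(2)[OF S_le E_le, of \<sigma> p] inc_ker_le_1[of S E \<sigma> p]
      by (cases "inc_ker S E \<sigma> p = 0") simp_all
  qed
  then show ?thesis by simp
qed

text \<open>Substituting \<open>\<sigma> = \<tau> + sqrt a *\<^sub>R \<rho>\<close> moves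
  \<open>a\<close> from the kernel into the argument of \<open>inc S E\<close>; the Jacobian
  \<open>a\<close> cancels the prefactor. Dominated convergence applies because
  \<open>inc S E\<close> is bounded.\<close>

lemma mollified_tendsto:
  assumes cont: "isCont (inc S E) \<tau>"
  shows "(\<lambda>n. mollified (1 / real (Suc n)) \<tau>) \<longlonglongrightarrow> (2*pi)\<^sup>2 * inc S E \<tau>"
proof -
  let ?a = "\<lambda>n. 1 / real (Suc n)"
  let ?g = "\<lambda>\<rho>::complex. 2*pi * exp (- (1/2) * (norm \<rho>)\<^sup>2)"
  have g: "has_bochner_integral lborel ?g ((2*pi)\<^sup>2)"
  proof -
    have "has_bochner_integral lborel (\<lambda>x::complex. complex_of_real (exp (- (1/2) * (norm x)\<^sup>2))) (of_real (2*pi))"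
      using gaussian_fourier[of 1 "0::complex"] by simp
    then have "has_bochner_integral lborel (\<lambda>x::complex. exp (- (1/2) * (norm x)\<^sup>2)) (2*pi)"
      by (simp only: has_bochner_integral_iff complex_of_real_integrable_eq integral_complex_of_real of_real_eq_iff)
    from has_bochner_integral_mult_right[OF this, of "2*pi"] show ?thesis
      by (simp add: power2_eq_square)
  qed
  have resc: "mollified a \<tau> = (\<integral>\<rho>. ?g \<rho> * inc S E (\<tau> + sqrt a *\<^sub>R \<rho>) \<partial>lborel)" if a: "0 < a" for a
  proof -
    have pw: "2*pi/a * exp (- (norm ((\<tau> + sqrt a *\<^sub>R \<rho>) - \<tau>))\<^sup>2 / (2*a)) * c = (1/a) * (?g \<rho> * c)" for \<rho> c
      using a by (simp add: power_mult_distrib)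
    have "mollified a \<tau> = \<bar>sqrt a\<bar> ^ DIM(complex) *\<^sub>R (\<integral>\<rho>. 2*pi/a * exp (- (norm ((\<tau> + sqrt a *\<^sub>R \<rho>) - \<tau>))\<^sup>2 / (2*a)) * inc S E (\<tau> + sqrt a *\<^sub>R \<rho>) \<partial>lborel)"
      unfolding mollified_def using a by (intro integral_lborel_affine) auto
    also have "\<dots> = (\<integral>\<rho>. ?g \<rho> * inc S E (\<tau> + sqrt a *\<^sub>R \<rho>) \<partial>lborel)"
      unfolding pw integral_mult_right_zero using a by simp
    finally show ?thesis .
  qed
  have "(\<lambda>n. \<integral>\<rho>. ?g \<rho> * inc S E (\<tau> + sqrt (?a n) *\<^sub>R \<rho>) \<partial>lborel) \<longlonglongrightarrow> (\<integral>\<rho>. ?g \<rho> * inc S E \<tau> \<partial>lborel)"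
  proof (rule integral_dominated_convergence)
    let ?M = "measure lborel (cball (0 :: (complex \<times> complex) \<times> pt) (2 * R))"
    show "integrable lborel (\<lambda>\<rho>. ?g \<rho> * ?M)"
      using g by (intro integrable_mult_left) (simp add: has_bochner_integral_iff)
    show "AE \<rho> in lborel. (\<lambda>n. ?g \<rho> * inc S E (\<tau> + sqrt (?a n) *\<^sub>R \<rho>)) \<longlonglongrightarrow> ?g \<rho> * inc S E \<tau>"
    proof (intro AE_I2 tendsto_mult tendsto_const)
      fix \<rho> :: complex
      have "(\<lambda>n. sqrt (?a n)) \<longlonglongrightarrow> sqrt 0"
        by (intro tendsto_real_sqrt LIMSEQ_Suc lim_1_over_n)
      then have "(\<lambda>n. \<tau> + sqrt (?a n) *\<^sub>R \<rho>) \<longlonglongrightarrow> \<tau> + 0 *\<^sub>R \<rho>"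
        by (intro tendsto_intros) simp
      then show "(\<lambda>n. inc S E (\<tau> + sqrt (?a n) *\<^sub>R \<rho>)) \<longlonglongrightarrow> inc S E \<tau>"
        using isCont_tendsto_compose[OF cont] by simp
    qed
    show "AE \<rho> in lborel. norm (?g \<rho> * inc S E (\<tau> + sqrt (?a n) *\<^sub>R \<rho>)) \<le> ?g \<rho> * ?M" for n
      by (intro AE_I2) (simp add: abs_mult inc_nonneg inc_bounded)
  qed measurable
  moreover have "(\<integral>\<rho>. ?g \<rho> * inc S E \<tau> \<partial>lborel) = (2*pi)\<^sup>2 * inc S E \<tau>"
    unfolding integral_mult_left_zero has_bochner_integral_integral_eq[OF g] ..
  ultimately show ?thesis by (simp only: resc zero_less_divide_1_iff of_nat_0_less_iff zero_less_Suc)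
qed

section \<open>Continuity of the displacement volume\<close>

lemma inc_le_measure: "inc S E \<sigma> \<le> measure lborel (cball (0 :: complex \<times> complex) R) * measure lborel S"
proof -
  define C where "C = cball (0 :: complex \<times> complex) R"
  have [measurable]: "C \<in> sets borel" by (simp add: C_def)
  let ?c = "\<lambda>v. indicator C v :: ennreal"
  let ?k = "\<lambda>p. ?c (snd (snd p)) * indicator S (\<sigma> - fst (snd p) - bil (snd (snd p)) (fst p), fst p)"
  have m: "(\<lambda>p. ?k p) \<in> borel_measurable borel" by measurable
  have my: "(\<lambda>y. ?k (x, y)) \<in> borel_measurable borel" for x by measurable
  have mS: "(indicator S :: pt \<Rightarrow> ennreal) \<in> borel_measurable borel" by measurable
  have mS': "(\<lambda>x. \<integral>\<^sup>+z. indicator S (z, x) \<partial>lborel) \<in> borel_measurable lborel"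
    using lborel_nn_integral_measurable_fst[of "\<lambda>q. indicator S (snd q, fst q) :: ennreal"] by simp
  have fin: "emeasure lborel C = ennreal (measure lborel C)"
    unfolding C_def using emeasure_lborel_cball_finite[of "0 :: complex \<times> complex" R] by (intro emeasure_eq_ennreal_measure) auto
  have "ennreal (inc S E \<sigma>) \<le> (\<integral>\<^sup>+p. ?k p \<partial>lborel)"
    unfolding inc_nn_integral
  proof (rule nn_integral_mono)
    fix p :: "(complex \<times> complex) \<times> pt"
    have "norm (snd (snd p)) \<le> R" if "snd p \<in> E"
      using that E_le norm_snd_le_norm[of "snd p"] by force
    then show "ennreal (inc_ker S E \<sigma> p) \<le> ?k p"
      by (auto simp: inc_ker_def indicator_def C_def)
  qed
  also have "\<dots> = (\<integral>\<^sup>+x. \<integral>\<^sup>+v. \<integral>\<^sup>+s. ?k (x, (s, v)) \<partial>lborel \<partial>lborel \<partial>lborel)"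
    unfolding lborel_nn_integral_fst[OF m] lborel_nn_integral_snd[OF my] ..
  also have "\<dots> = (\<integral>\<^sup>+x. \<integral>\<^sup>+v. ?c v * (\<integral>\<^sup>+z. indicator S (z, x) \<partial>lborel) \<partial>lborel \<partial>lborel)"
  proof (intro nn_integral_cong)
    fix x v :: "complex \<times> complex"
    \<comment> \<open>For fixed \<open>x\<close> and \<open>v\<close>, reflecting \<open>s\<close>
      gives the measure of the slice of \<open>S\<close> at \<open>x\<close>, whatever
      \<open>v\<close> and \<open>\<sigma>\<close> are; \<open>v\<close> only ranges over the ball
      \<open>C\<close>.\<close>
    have "(\<integral>\<^sup>+s. ?k (x, (s, v)) \<partial>lborel) = ?c v * (\<integral>\<^sup>+s. indicator S ((\<sigma> - bil v x) - s, x) \<partial>lborel)"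
      by (subst nn_integral_cmult[symmetric]) (simp_all add: algebra_simps)
    also have "(\<integral>\<^sup>+s. indicator S ((\<sigma> - bil v x) - s, x) \<partial>lborel) = (\<integral>\<^sup>+z. (indicator S (z, x) :: ennreal) \<partial>lborel)"
      by (rule nn_integral_lborel_reflect) measurable
    finally show "(\<integral>\<^sup>+s. ?k (x, (s, v)) \<partial>lborel) = ?c v * (\<integral>\<^sup>+z. indicator S (z, x) \<partial>lborel)" .
  qed
  also have "\<dots> = emeasure lborel C * emeasure lborel S"
    using mS' by (simp add: nn_integral_multc nn_integral_cmult lborel_nn_integral_snd[OF mS, symmetric])
  also have "\<dots> = ennreal (measure lborel C * measure lborel S)"
    unfolding fin emeasure_S by (simp add: ennreal_mult')
  finally show ?thesis
    by (subst (asm) ennreal_le_iff) (auto simp: C_def)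
qed

text \<open>A pair with displacement \<open>\<sigma> + h\<close> becomes one with displacement
  \<open>\<sigma>\<close> when its point of \<open>S\<close> moves by \<open>- (h, 0)\<close>,
  unless that point leaves \<open>S\<close>; the exceptions are bounded by
  \<open>inc_le_measure\<close>.\<close>

lemma inc_shift_le: "inc S E (\<sigma> + h) \<le> inc S E \<sigma> +
  measure lborel (cball (0 :: complex \<times> complex) R) * measure lborel (S - {q. q - (h, 0) \<in> S})"
proof -
  define D where "D = S - {q. q - (h, 0) \<in> S}"
  interpret D: bounded_sets D E R
    by unfold_locales (use S_le E_le in \<open>auto simp: D_def\<close>)
  have "inc S E (\<sigma> + h) \<le> (\<integral>p. inc_ker S E \<sigma> p + inc_ker D E (\<sigma> + h) p \<partial>lborel)"
    unfolding inc_def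
    by (intro integral_mono Bochner_Integration.integrable_add integrable_inc_ker D.integrable_inc_ker)
      (auto simp: inc_ker_def indicator_def D_def algebra_simps)
  also have "\<dots> = inc S E \<sigma> + inc D E (\<sigma> + h)"
    unfolding inc_def by (intro Bochner_Integration.integral_add integrable_inc_ker D.integrable_inc_ker)
  finally show ?thesis using D.inc_le_measure[of "\<sigma> + h"] by (simp add: D_def)
qed

lemma isCont_inc: "isCont (inc S E) \<sigma>"
proof -
  define C where "C = measure lborel (cball (0 :: complex \<times> complex) R)"
  have C: "0 \<le> C" by (simp add: C_def)
  show ?thesis
    unfolding isCont_def LIM_def
  proof (intro allI impI)
    fix e :: real assume e: "0 < e"
    \<comment> \<open>Dividing by \<open>C + 1\<close> also covers \<open>C = 0\<close> and makes
      \<open>C * e' < e\<close> strict, although the measure below is only bounded by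
      \<open>e'\<close>.\<close>
    define e' where "e' = e / (C + 1)"
    have e': "0 < e'" "C * e' < e" using e C by (auto simp: e'_def field_simps add_nonneg_pos)
    have "bounded S" using S_le bounded_cball bounded_subset by blast
    then obtain d where d: "0 < d" "\<And>h. norm h < d \<Longrightarrow> emeasure lborel (S - {q. q - h \<in> S}) < ennreal e'"
      using emeasure_Diff_translate_small[OF S_borel _ e'(1)] by metis
    have m: "C * measure lborel (S - {q. q - (h, 0) \<in> S}) < e" if "norm h < d" for h
    proof -
      have "measure lborel (S - {q. q - (h, 0) \<in> S}) \<le> e'"
        using d(2)[of "(h, 0)"] that e' unfolding measure_def
        by (intro enn2real_leI) (auto simp: norm_Pair)
      then show ?thesis
        using e'(2) C by (meson le_less_trans mult_left_mono)
    qed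
    \<comment> \<open>\<open>inc_shift_le\<close> is one-sided; the shifts from
      \<open>\<sigma>\<close> to \<open>s\<close> and back give both halves of the absolute
      value.\<close>
    have "dist (inc S E s) (inc S E \<sigma>) < e" if "dist s \<sigma> < d" for s
      using inc_shift_le[folded C_def, of \<sigma> "s - \<sigma>"] inc_shift_le[folded C_def, of s "\<sigma> - s"] m[of "s - \<sigma>"] m[of "\<sigma> - s"] that C
      by (simp add: dist_norm norm_minus_commute abs_less_iff)
    with d(1) show "\<exists>d>0. \<forall>s. s \<noteq> \<sigma> \<and> dist s \<sigma> < d \<longrightarrow> dist (inc S E s) (inc S E \<sigma>) < e" by blast
  qed
qed

section \<open>Quadratic bounds near a zero of the displacement volume\<close>

lemma inc_second_difference:
  assumes k: "0 < k"
  shows "inc S E t + inc S E (- t) - 2 * inc S E 0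
    \<le> (k * exp (R\<^sup>2) * measure lborel S + norm t ^ 4 * (2*pi)^4 * measure lborel E / k) / 2" (is "?l \<le> ?r")
proof -
  \<comment> \<open>Letting the damping tend to 0 produces a common factor
    \<open>(2*pi)\<^sup>2\<close>, which is divided out below. The weight \<open>k\<close> stays
    free until \<open>inc_quadratic_bound\<close>; optimising it here would give the geometric mean
    of the two measures.\<close>
  have "(\<lambda>n. mollified (1 / real (Suc n)) t + mollified (1 / real (Suc n)) (- t) - 2 * mollified (1 / real (Suc n)) 0)
    \<longlonglongrightarrow> (2*pi)\<^sup>2 * inc S E t + (2*pi)\<^sup>2 * inc S E (- t) - 2 * ((2*pi)\<^sup>2 * inc S E 0)"
    by (intro tendsto_intros mollified_tendsto isCont_inc)
  then have "(2*pi)\<^sup>2 * inc S E t + (2*pi)\<^sup>2 * inc S E (- t) - 2 * ((2*pi)\<^sup>2 * inc S E 0)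
      \<le> (k * exp (R\<^sup>2) * (2*pi)\<^sup>2 * measure lborel S + norm t ^ 4 * (2*pi)^6 * measure lborel E / k) / 2"
    by (rule LIMSEQ_le_const2) (use mollified_second_difference[OF _ k] in auto)
  also have "\<dots> = (2*pi)\<^sup>2 * ?r"
    by (simp add: distrib_left flip: power_add)
  finally have "(2*pi)\<^sup>2 * ?l \<le> (2*pi)\<^sup>2 * ?r" by (simp add: algebra_simps)
  then show ?thesis by (subst (asm) mult_le_cancel_left_pos) auto
qed


text \<open>Since \<open>inc S E\<close> vanishes at 0 and is nonnegative at \<open>- t\<close>, the
  second difference is at least \<open>inc S E t\<close>.\<close>

lemma inc_le_of_inc_0:
  assumes "inc S E 0 = 0" and k: "0 < k"
  shows "inc S E t \<le> (k * exp (R\<^sup>2) * measure lborel S + norm t ^ 4 * (2*pi)^4 * measure lborel E / k) / 2"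
  using inc_second_difference[OF k, of t] inc_nonneg[of "- t"] assms(1) by linarith

text \<open>The points of \<open>E\<close> that the translation by \<open>-t\<close> moves out of \<open>E\<close>; only these contribute to \<open>inc S E t\<close>.\<close>

definition shift_diff :: "complex \<Rightarrow> pt set" where "shift_diff t = E - {y. y - (t, 0) \<in> E}"

lemma bounded_sets_shift_diff: "bounded_sets S (shift_diff t) R"
  by unfold_locales (use S_le E_le in \<open>auto simp: shift_diff_def\<close>)

text \<open>If \<open>(s, v)\<close> and \<open>(s - t, v)\<close> both lie in \<open>E\<close>,
  replacing \<open>s\<close> by \<open>s - t\<close> turns a pair with displacement \<open>t\<close>
  into one with displacement 0. Such pairs have volume zero, so only \<open>shift_diff t\<close>
  remains.\<close>

lemma inc_le_inc_shift_diff: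
  assumes "inc S E 0 = 0"
  shows "inc S E t \<le> inc S (shift_diff t) t"
proof -
  interpret D: bounded_sets S "shift_diff t" R by (rule bounded_sets_shift_diff)
  let ?u = "(0, (- t, 0)) :: (complex \<times> complex) \<times> pt"
  have "(\<integral>p. inc_ker S E 0 (?u + p) \<partial>lborel) = (\<integral>p. inc_ker S E 0 p \<partial>lborel)"
    by (rule integral_lborel_translate) measurable
  then have 0: "(\<integral>p. inc_ker S E 0 (?u + p) \<partial>lborel) = 0"
    using assms by (simp add: inc_def)
  have i: "integrable lborel (\<lambda>p. inc_ker S E 0 (?u + p))"
  proof (rule integrable_bounded_support[where B = 1 and R = "2 * R + norm ?u"])
    fix p :: "(complex \<times> complex) \<times> pt" assume p: "norm p > 2 * R + norm ?u"
    have "norm p \<le> norm (?u + p) + norm ?u"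
      using norm_triangle_ineq4[of "?u + p" ?u] by simp
    then show "inc_ker S E 0 (?u + p) = 0"
      using inc_ker_support(2)[OF S_le E_le, of 0 "?u + p"] p by force
  qed (simp_all add: inc_ker_nonneg inc_ker_le_1)
  have "inc S E t \<le> (\<integral>p. inc_ker S (shift_diff t) t p + inc_ker S E 0 (?u + p) \<partial>lborel)"
    unfolding inc_def
  proof (intro integral_mono Bochner_Integration.integrable_add integrable_inc_ker D.integrable_inc_ker i)
    fix p :: "(complex \<times> complex) \<times> pt"
    obtain x s v where p: "p = (x, (s, v))" by (cases p) auto
    show "inc_ker S E t p \<le> inc_ker S (shift_diff t) t p + inc_ker S E 0 (?u + p)"
      by (auto simp: inc_ker_def indicator_def shift_diff_def p algebra_simps)
  qed
  also have "\<dots> = inc S (shift_diff t) t + 0"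
    unfolding inc_def using 0 by (subst Bochner_Integration.integral_add[OF D.integrable_inc_ker i]) simp
  finally show ?thesis by simp
qed

lemma measure_le_cball:
  fixes A :: "pt set"
  assumes "A \<in> sets borel" "A \<subseteq> cball 0 R"
  shows "measure lborel A \<le> measure lborel (cball (0::pt) R)"
  using assms by (intro measure_mono_fmeasurable fmeasurable_compact compact_cball) simp_all

text \<open>The vanishing at 0 passes to the subset \<open>shift_diff t\<close>. With
  \<open>k = \<eta> * (norm t)\<^sup>2\<close> both terms of \<open>inc_le_of_inc_0\<close> scale
  like \<open>(norm t)\<^sup>2\<close>; then \<open>\<eta>\<close> controls the first term and the
  measure of \<open>shift_diff t\<close> the second.\<close>

lemma inc_quadratic_bound:
  assumes "inc S E 0 = 0" and \<eta>: "0 < \<eta>" and t: "t \<noteq> 0"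
  shows "inc S E t / (norm t)\<^sup>2 \<le> (\<eta> * exp (R\<^sup>2) * measure lborel (cball (0::pt) R) + (2*pi)^4 * measure lborel (shift_diff t) / \<eta>) / 2"
proof -
  interpret D: bounded_sets S "shift_diff t" R by (rule bounded_sets_shift_diff)
  have b0: "inc S (shift_diff t) 0 = 0"
  proof -
    have "inc S (shift_diff t) 0 \<le> inc S E 0"
      unfolding inc_def
      by (intro integral_mono integrable_inc_ker D.integrable_inc_ker)
        (auto simp: inc_ker_def indicator_def shift_diff_def)
    then show ?thesis using assms(1) D.inc_nonneg[of 0] by simp
  qed
  have "inc S E t \<le> ((\<eta> * (norm t)\<^sup>2) * exp (R\<^sup>2) * measure lborel S + norm t ^ 4 * (2*pi)^4 * measure lborel (shift_diff t) / (\<eta> * (norm t)\<^sup>2)) / 2"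
    using D.inc_le_of_inc_0[OF b0, of "\<eta> * (norm t)\<^sup>2" t] inc_le_inc_shift_diff[OF assms(1), of t] \<eta> t by simp
  also have "\<dots> = (norm t)\<^sup>2 * ((\<eta> * exp (R\<^sup>2) * measure lborel S + (2*pi)^4 * measure lborel (shift_diff t) / \<eta>) / 2)"
    using \<eta> t by (simp add: field_simps power2_eq_square power4_eq_xxxx)
  also have "\<dots> \<le> (norm t)\<^sup>2 * ((\<eta> * exp (R\<^sup>2) * measure lborel (cball (0::pt) R) + (2*pi)^4 * measure lborel (shift_diff t) / \<eta>) / 2)"
    using \<eta> measure_le_cball[OF S_borel S_le] by (intro mult_left_mono divide_right_mono add_right_mono) auto
  finally show ?thesis
    using t by (simp add: divide_le_eq mult.commute)
qed

text \<open>The choice \<open>\<eta> = 1\<close> gives a bound that depends on \<open>R\<close>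
  only: the majorant for dominated convergence over the hidden variable.\<close>

lemma inc_quadratic_bound_uniform:
  assumes "inc S E 0 = 0" and t: "t \<noteq> 0"
  shows "inc S E t / (norm t)\<^sup>2 \<le> (exp (R\<^sup>2) + (2*pi)^4) * measure lborel (cball (0::pt) R)"
proof -
  interpret D: bounded_sets S "shift_diff t" R by (rule bounded_sets_shift_diff)
  let ?V = "measure lborel (cball (0::pt) R)"
  have "inc S E t / (norm t)\<^sup>2 \<le> (exp (R\<^sup>2) * ?V + (2*pi)^4 * measure lborel (shift_diff t)) / 2"
    using inc_quadratic_bound[OF assms(1) zero_less_one t] by simp
  also have "\<dots> \<le> (exp (R\<^sup>2) * ?V + (2*pi)^4 * ?V) / 2"
    using measure_le_cball[OF D.E_borel D.E_le] by (intro divide_right_mono add_left_mono mult_left_mono) auto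
  also have "\<dots> \<le> (exp (R\<^sup>2) * ?V + (2*pi)^4 * ?V)"
    by (simp add: field_simps)
  finally show ?thesis by (simp add: distrib_right)
qed

text \<open>First \<open>\<eta>\<close> makes the first term of \<open>inc_quadratic_bound\<close>
  small, then \<open>emeasure_Diff_translate_small\<close> makes the second small for short
  \<open>t n\<close>.\<close>

lemma inc_little_o:
  assumes "inc S E 0 = 0" and t: "t \<longlonglongrightarrow> 0" "\<And>n. t n \<noteq> 0"
  shows "(\<lambda>n. inc S E (t n) / (norm (t n))\<^sup>2) \<longlonglongrightarrow> 0"
proof (rule LIMSEQ_I)
  fix e :: real assume e: "0 < e"
  \<comment> \<open>The summand 1 keeps \<open>V\<close> positive and makes the first term,
    \<open>\<eta> * (V - 1)\<close>, strictly less than \<open>e\<close>; \<open>e'\<close> below is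
    chosen so that the second term is at most \<open>e\<close>.\<close>
  define V where "V = exp (R\<^sup>2) * measure lborel (cball (0::pt) R) + 1"
  have V: "V \<ge> 1" by (simp add: V_def)
  define \<eta> where "\<eta> = e / V"
  have \<eta>: "0 < \<eta>" "\<eta> * V = e" using e V by (auto simp: \<eta>_def)
  define e' where "e' = \<eta> * e / (2*pi)^4"
  have e': "0 < e'" "(2*pi)^4 * e' / \<eta> = e" using e \<eta> by (auto simp: e'_def)
  have "bounded E" using E_le bounded_cball bounded_subset by blast
  then obtain d where d: "0 < d" "\<And>h. norm h < d \<Longrightarrow> emeasure lborel (E - {q. q - h \<in> E}) < ennreal e'"
    using emeasure_Diff_translate_small[OF E_borel _ e'(1)] by metis
  have small: "inc S E s / (norm s)\<^sup>2 < e" if s: "norm s < d" "s \<noteq> 0" for s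
  proof -
    have m: "measure lborel (shift_diff s) \<le> e'"
      unfolding measure_def shift_diff_def using d(2)[of "(s, 0)"] s e'(1)
      by (intro enn2real_leI) (auto simp: norm_Pair)
    have "inc S E s / (norm s)\<^sup>2 \<le> (\<eta> * (V - 1) + (2*pi)^4 * measure lborel (shift_diff s) / \<eta>) / 2"
      using inc_quadratic_bound[OF assms(1) \<eta>(1) s(2)] by (simp add: V_def mult.assoc)
    also have "\<dots> \<le> (\<eta> * (V - 1) + (2*pi)^4 * e' / \<eta>) / 2"
      using \<eta> m by (intro divide_right_mono add_left_mono mult_left_mono) auto
    also have "\<dots> < e" using \<eta> e' by (simp add: algebra_simps)
    finally show ?thesis .
  qed
  obtain n0 where "\<And>n. n \<ge> n0 \<Longrightarrow> norm (t n) < d"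
    using LIMSEQ_D[OF t(1) d(1)] by auto
  then show "\<exists>no. \<forall>n\<ge>no. norm (inc S E (t n) / (norm (t n))\<^sup>2 - 0) < e"
    using small t(2) inc_nonneg by (intro exI[of _ n0]) auto
qed

end

section \<open>Averaging over the hidden variable\<close>

text \<open>The displacement of a pair, equal to the dot product of the vectors that the two parties
  measure; see \<open>sum_alice_bob\<close>.\<close>

definition pairing :: "pt \<Rightarrow> pt \<Rightarrow> complex" where
  "pairing x y = fst x + fst y + bil (snd y) (snd x)"

text \<open>The product \<open>f * g\<close> is at most the indicator of the event that both factors
  are positive. The zeros of the pairing force \<open>inc\<close> of the positivity sets to vanish
  at 0 almost surely, so its averages at \<open>t n\<close> are of smaller order than
  \<open>(norm (t n))\<^sup>2\<close>, against the averaged lower bound.\<close>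

lemma no_bounded_nonneg_factorization:
  fixes f g :: "'c \<Rightarrow> pt \<Rightarrow> 'l \<Rightarrow> real"
  assumes "prob_space M" and fin: "finite I" and \<kappa>: "0 < \<kappa>"
    and fm: "\<And>c. c \<in> I \<Longrightarrow> (\<lambda>(x, l). f c x l) \<in> borel_measurable (borel \<Otimes>\<^sub>M M)"
    and gm: "\<And>c. c \<in> I \<Longrightarrow> (\<lambda>(y, l). g c y l) \<in> borel_measurable (borel \<Otimes>\<^sub>M M)"
    and f: "\<And>c x l. c \<in> I \<Longrightarrow> l \<in> space M \<Longrightarrow> 0 \<le> f c x l \<and> f c x l \<le> 1"
    and g: "\<And>c y l. c \<in> I \<Longrightarrow> l \<in> space M \<Longrightarrow> 0 \<le> g c y l \<and> g c y l \<le> 1"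
    and zero: "\<And>x y. pairing x y = 0 \<Longrightarrow> (\<integral>l. (\<Sum>c\<in>I. f c x l * g c y l) \<partial>M) = 0"
    and lower: "\<And>x y. norm x \<le> 5 \<Longrightarrow> norm y \<le> 1 \<Longrightarrow>
      \<kappa> * (norm (pairing x y))\<^sup>2 \<le> (\<integral>l. (\<Sum>c\<in>I. f c x l * g c y l) \<partial>M)"
  shows False
proof -
  interpret prob_space M by fact
  interpret pair_sigma_finite "lborel :: ((complex \<times> complex) \<times> pt) measure" M ..
  define S where "S c l = {x. norm x \<le> 5 \<and> 0 < f c x l}" for c l
  define N where "N c l = {y. norm y \<le> 1 \<and> 0 < g c y l}" for c l
  \<comment> \<open>\<open>pos \<sigma> p\<close> is the point of Alice that has displacement
    \<open>\<sigma>\<close> against Bob's point \<open>snd p\<close> and whose second component is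
    \<open>fst p\<close>.\<close>
  define pos where "pos \<sigma> p = (\<sigma> - fst (snd p) - bil (snd (snd p)) (fst p), fst p)" for \<sigma> and p :: "(complex \<times> complex) \<times> pt"
  have [measurable]: "pos \<sigma> \<in> borel_measurable borel" for \<sigma> unfolding pos_def by measurable
  have pairing_pos: "pairing (pos \<sigma> p) (snd p) = \<sigma>" for \<sigma> p by (simp add: pairing_def pos_def)
  have ker: "inc_ker (S c l) (N c l) \<sigma> p = (if norm (pos \<sigma> p) \<le> 5 \<and> 0 < f c (pos \<sigma> p) l \<and> norm (snd p) \<le> 1 \<and> 0 < g c (snd p) l then 1 else 0)" for c l \<sigma> p
    by (auto simp: inc_ker_def S_def N_def pos_def indicator_def)
  have fm': "(\<lambda>q. f c (h q) (k q)) \<in> borel_measurable L" and gm': "(\<lambda>q. g c (h q) (k q)) \<in> borel_measurable L"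
    if "c \<in> I" "h \<in> borel_measurable L" "k \<in> measurable L M" for c h k and L :: "'z measure"
    using measurable_compose[OF measurable_Pair[OF that(2,3)] fm[OF that(1)]]
      measurable_compose[OF measurable_Pair[OF that(2,3)] gm[OF that(1)]] by simp_all
  have bs: "bounded_sets (S c l) (N c l) 5" if c: "c \<in> I" and l: "l \<in> space M" for c l
  proof
    have [measurable]: "(\<lambda>x. f c x l) \<in> borel_measurable borel" "(\<lambda>x. g c x l) \<in> borel_measurable borel"
      using fm'[OF c, of "\<lambda>x. x" borel "\<lambda>_. l"] gm'[OF c, of "\<lambda>x. x" borel "\<lambda>_. l"] l by simp_all
    show "S c l \<in> sets borel" "N c l \<in> sets borel"
      unfolding S_def N_def by measurable
  qed (auto simp: S_def N_def)
  have km: "(\<lambda>(p, l). inc_ker (S c l) (N c l) \<sigma> p) \<in> borel_measurable (lborel \<Otimes>\<^sub>M M)" if c: "c \<in> I" for c \<sigma>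
  proof -
    have [measurable]: "(\<lambda>q. f c (pos \<sigma> (fst q)) (snd q)) \<in> borel_measurable (lborel \<Otimes>\<^sub>M M)"
      "(\<lambda>q. g c (snd (fst q)) (snd q)) \<in> borel_measurable (lborel \<Otimes>\<^sub>M M)"
      by (rule fm'[OF c] gm'[OF c]; measurable)+
    show ?thesis unfolding ker case_prod_unfold by measurable
  qed
  have ki: "(\<integral>\<^sup>+l. \<integral>\<^sup>+p. ennreal (inc_ker (S c l) (N c l) \<sigma> p) \<partial>lborel \<partial>M) = (\<integral>\<^sup>+p. \<integral>\<^sup>+l. ennreal (inc_ker (S c l) (N c l) \<sigma> p) \<partial>M \<partial>lborel)" if c: "c \<in> I" for c \<sigma>
    using Fubini'[of "\<lambda>p l. ennreal (inc_ker (S c l) (N c l) \<sigma> p)"] km[OF c, of \<sigma>] by (simp add: case_prod_unfold)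
  have incn: "(\<integral>\<^sup>+l. ennreal (inc (S c l) (N c l) \<sigma>) \<partial>M) = (\<integral>\<^sup>+l. \<integral>\<^sup>+p. ennreal (inc_ker (S c l) (N c l) \<sigma> p) \<partial>lborel \<partial>M)" if c: "c \<in> I" for c \<sigma>
    by (intro nn_integral_cong bounded_sets.inc_nn_integral[OF bs[OF c]])
  have incm: "(\<lambda>l. inc (S c l) (N c l) \<sigma>) \<in> borel_measurable M" if c: "c \<in> I" for c \<sigma>
    unfolding inc_def
    by (rule lborel.borel_measurable_lebesgue_integral)
      (use measurable_pair_swap[OF km[OF c, of \<sigma>]] in \<open>simp add: case_prod_unfold\<close>)
  have fgm: "(\<lambda>l. f c x l * g c y l) \<in> borel_measurable M" if "c \<in> I" for c x y
    using fm'[OF that, of "\<lambda>_. x" M "\<lambda>l. l"] gm'[OF that, of "\<lambda>_. y" M "\<lambda>l. l"] by simp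
  have fgi: "integrable M (\<lambda>l. f c x l * g c y l)" if "c \<in> I" for c x y
  proof (rule integrable_const_bound[where B = 1])
    show "AE l in M. norm (f c x l * g c y l) \<le> 1"
    proof (rule AE_I2)
      fix l assume l: "l \<in> space M"
      show "norm (f c x l * g c y l) \<le> 1"
        using f[OF that l, of x] g[OF that l, of y] by (simp add: abs_mult mult_le_one)
    qed
  qed (rule fgm[OF that])
  have fg0: "0 \<le> (\<Sum>c\<in>I. f c x l * g c y l)" if "l \<in> space M" for x y l
    by (intro sum_nonneg mult_nonneg_nonneg) (use f g that in blast)+
  have fgsi: "integrable M (\<lambda>l. \<Sum>c\<in>I. f c x l * g c y l)" for x y
    by (intro Bochner_Integration.integrable_sum fgi)
  \<comment> \<open>For every \<open>p\<close> the sum of nonnegative terms vanishes almost surely,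
    hence each term does. The null set depends on \<open>p\<close>; Tonelli in \<open>ki\<close>
    yields a single null set for the integral over \<open>p\<close>.\<close>
  have AE0: "AE l in M. inc (S c l) (N c l) 0 = 0" if c: "c \<in> I" for c
  proof -
    have "(\<integral>\<^sup>+l. ennreal (inc_ker (S c l) (N c l) 0 p) \<partial>M) = 0" for p
    proof -
      have "(\<integral>l. (\<Sum>c\<in>I. f c (pos 0 p) l * g c (snd p) l) \<partial>M) = 0"
        by (rule zero) (rule pairing_pos)
      then have "AE l in M. (\<Sum>c\<in>I. f c (pos 0 p) l * g c (snd p) l) = 0"
        by (subst (asm) integral_nonneg_eq_0_iff_AE[OF fgsi]) (rule AE_I2[OF fg0])
      then have "AE l in M. inc_ker (S c l) (N c l) 0 p = 0"
      proof (rule AE_mp, intro AE_I2 impI)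
        fix l assume l: "l \<in> space M" and "(\<Sum>c\<in>I. f c (pos 0 p) l * g c (snd p) l) = 0"
        then have "f c (pos 0 p) l * g c (snd p) l = 0"
          using fin c by (subst (asm) sum_nonneg_eq_0_iff) (use f g l in \<open>blast intro: mult_nonneg_nonneg\<close>)+
        then show "inc_ker (S c l) (N c l) 0 p = 0" by (auto simp: ker)
      qed
      then have "AE l in M. ennreal (inc_ker (S c l) (N c l) 0 p) = 0" by (rule AE_mp) simp
      then show ?thesis by (subst nn_integral_cong_AE[where v = "\<lambda>_. 0"]) auto
    qed
    then have "(\<integral>\<^sup>+l. ennreal (inc (S c l) (N c l) 0) \<partial>M) = 0"
      unfolding incn[OF c] ki[OF c] by simp
    then have "AE l in M. ennreal (inc (S c l) (N c l) 0) = 0"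
      using incm[OF c] by (subst (asm) nn_integral_0_iff_AE) auto
    then show ?thesis
      by (rule AE_mp) (auto intro!: AE_I2 simp: ennreal_eq_0_iff bounded_sets.inc_nonneg[OF bs[OF c]] order_antisym)
  qed
  define t where "t n = complex_of_real (1 / real (Suc n))" for n
  have t: "t \<longlonglongrightarrow> 0" "t n \<noteq> 0" "norm (t n) \<le> 1" for n
  proof -
    have "(\<lambda>n. complex_of_real (1 / real (Suc n))) \<longlonglongrightarrow> complex_of_real 0"
      by (intro tendsto_of_real LIMSEQ_Suc lim_1_over_n)
    then show "t \<longlonglongrightarrow> 0" by (simp add: t_def[abs_def])
    show "t n \<noteq> 0" "norm (t n) \<le> 1" by (simp_all add: t_def norm_divide del: of_nat_Suc)
  qed
  let ?K = "(exp (5\<^sup>2) + (2*pi)^4) * measure lborel (cball (0::pt) 5)"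
  have lim: "(\<lambda>n. \<integral>l. inc (S c l) (N c l) (t n) / (norm (t n))\<^sup>2 \<partial>M) \<longlonglongrightarrow> (\<integral>l. 0 \<partial>M)" if c: "c \<in> I" for c
  proof (rule integral_dominated_convergence)
    show "integrable M (\<lambda>_. ?K)" by simp
    show "AE l in M. (\<lambda>n. inc (S c l) (N c l) (t n) / (norm (t n))\<^sup>2) \<longlonglongrightarrow> 0"
      using AE0[OF c] by (rule AE_mp) (auto intro!: AE_I2 bounded_sets.inc_little_o[OF bs[OF c]] t)
    show "AE l in M. norm (inc (S c l) (N c l) (t n) / (norm (t n))\<^sup>2) \<le> ?K" for n
      using AE0[OF c] 
    proof (rule AE_mp, intro AE_I2 impI)
      fix l assume l: "l \<in> space M" and "inc (S c l) (N c l) 0 = 0"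
      then show "norm (inc (S c l) (N c l) (t n) / (norm (t n))\<^sup>2) \<le> ?K"
        using bounded_sets.inc_quadratic_bound_uniform[OF bs[OF c l] _ t(2)] bounded_sets.inc_nonneg[OF bs[OF c l]] by simp
    qed
  qed (use incm[OF c] in auto)
  \<comment> \<open>For \<open>p \<in> P\<close> and \<open>norm \<sigma> \<le> 1\<close> the first
    coordinate of \<open>pos \<sigma> p\<close> has norm at most 1 + 1 + 2 and the second at most 1.
    This is where the radius 5 comes from.\<close>
  define P where "P = cball (0::complex \<times> complex) 1 \<times> cball (0::pt) 1"
  have cP: "compact P" unfolding P_def by (intro compact_Times compact_cball)
  then have Pm [measurable]: "P \<in> sets borel" by (intro borel_closed compact_imp_closed)
  have "ball (0 :: (complex \<times> complex) \<times> pt) 1 \<subseteq> P"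
  proof
    fix p :: "(complex \<times> complex) \<times> pt" assume "p \<in> ball 0 1"
    then show "p \<in> P"
      using norm_fst_le_norm[of p] norm_snd_le_norm[of p] by (simp add: P_def mem_Times_iff)
  qed
  then have "emeasure lborel (ball (0 :: (complex \<times> complex) \<times> pt) 1) \<le> emeasure lborel P"
    by (intro emeasure_mono) simp_all
  moreover have "emeasure lborel (ball (0 :: (complex \<times> complex) \<times> pt) 1) \<noteq> 0"
    using open_not_negligible[of "ball (0 :: (complex \<times> complex) \<times> pt) 1"]
    by (auto simp: negligible_iff_emeasure0)
  ultimately have P0: "emeasure lborel P \<noteq> 0" by auto
  have Pfin: "emeasure lborel P = ennreal (measure lborel P)"
    using emeasure_compact_finite[OF cP] by (intro emeasure_eq_ennreal_measure) auto
  with P0 have P0': "measure lborel P > 0"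
    by (metis ennreal_0 measure_nonneg order_less_le)
  have pos_le: "norm (pos \<sigma> p) \<le> 5" if "p \<in> P" "norm \<sigma> \<le> 1" for \<sigma> p
  proof -
    obtain x s v where p: "p = (x, (s, v))" by (cases p) auto
    have n: "norm x \<le> 1" "norm s \<le> 1" "norm v \<le> 1"
      using that norm_fst_le[of s v] norm_snd_le[of v s] by (auto simp: P_def p)
    have "norm (bil v x) \<le> 2"
      using norm_bil_le[of v x] mult_mono[OF n(3,1)] by auto
    then have "norm (\<sigma> - s - bil v x) \<le> 4"
      using norm_triangle_ineq4[of "\<sigma> - s" "bil v x"] norm_triangle_ineq4[of \<sigma> s] n that(2) by linarith
    then show ?thesis
      using norm_Pair_le[of "\<sigma> - s - bil v x" x] n by (simp add: pos_def p)
  qed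
  have kmp: "(\<lambda>p. \<integral>\<^sup>+l. ennreal (inc_ker (S c l) (N c l) \<sigma> p) \<partial>M) \<in> borel_measurable lborel" if c: "c \<in> I" for c \<sigma>
  proof -
    have "(\<lambda>q. ennreal (inc_ker (S c (snd q)) (N c (snd q)) \<sigma> (fst q))) \<in> borel_measurable (lborel \<Otimes>\<^sub>M M)"
      using km[OF c, of \<sigma>] by (simp add: case_prod_unfold)
    from sigma_finite_measure.borel_measurable_nn_integral_fst[OF prob_space_imp_sigma_finite[OF assms(1)] this] show ?thesis by simp
  qed
  have kml: "(\<lambda>l. inc_ker (S c l) (N c l) \<sigma> p) \<in> borel_measurable M" if c: "c \<in> I" for c \<sigma> p
    using measurable_Pair2[OF km[OF c, of \<sigma>], of p] by simp
  \<comment> \<open>The lower bound at displacement \<open>t n\<close> is integrated over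
    \<open>P\<close>; bounding \<open>f * g\<close> by \<open>inc_ker\<close> and applying Tonelli
    gives \<open>inc\<close>.\<close>
  have main: "\<kappa> * (norm (t n))\<^sup>2 * measure lborel P \<le> (\<Sum>c\<in>I. \<integral>l. inc (S c l) (N c l) (t n) \<partial>M)" for n
  proof -
    have pw: "ennreal (\<kappa> * (norm (t n))\<^sup>2) \<le> (\<Sum>c\<in>I. \<integral>\<^sup>+l. ennreal (inc_ker (S c l) (N c l) (t n) p) \<partial>M)" if p: "p \<in> P" for p
    proof -
      have p1: "norm (pos (t n) p) \<le> 5" "norm (snd p) \<le> 1"
        using pos_le[OF p t(3)] p by (auto simp: P_def)
      have "ennreal (\<kappa> * (norm (t n))\<^sup>2) \<le> ennreal (\<integral>l. (\<Sum>c\<in>I. f c (pos (t n) p) l * g c (snd p) l) \<partial>M)"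
        using lower[OF p1] by (intro ennreal_leI) (simp add: pairing_pos)
      also have "\<dots> = (\<integral>\<^sup>+l. ennreal (\<Sum>c\<in>I. f c (pos (t n) p) l * g c (snd p) l) \<partial>M)"
        by (rule nn_integral_eq_integral[OF fgsi AE_I2[OF fg0], symmetric])
      also have "\<dots> \<le> (\<integral>\<^sup>+l. (\<Sum>c\<in>I. ennreal (inc_ker (S c l) (N c l) (t n) p)) \<partial>M)"
      proof (rule nn_integral_mono)
        fix l assume l: "l \<in> space M"
        have "f c (pos (t n) p) l * g c (snd p) l \<le> inc_ker (S c l) (N c l) (t n) p" if c: "c \<in> I" for c
          using f[OF c l, of "pos (t n) p"] g[OF c l, of "snd p"] p1
          by (auto simp: ker less_le intro: mult_le_one)
        then show "ennreal (\<Sum>c\<in>I. f c (pos (t n) p) l * g c (snd p) l) \<le> (\<Sum>c\<in>I. ennreal (inc_ker (S c l) (N c l) (t n) p))"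
          by (subst sum_ennreal) (auto intro!: ennreal_leI sum_mono inc_ker_nonneg)
      qed
      also have "\<dots> = (\<Sum>c\<in>I. \<integral>\<^sup>+l. ennreal (inc_ker (S c l) (N c l) (t n) p) \<partial>M)"
        by (intro nn_integral_sum) (use kml in auto)
      finally show ?thesis .
    qed
    have "ennreal (\<kappa> * (norm (t n))\<^sup>2 * measure lborel P) = (\<integral>\<^sup>+p. ennreal (\<kappa> * (norm (t n))\<^sup>2) * indicator P p \<partial>lborel)"
      using \<kappa> Pfin by (simp add: nn_integral_cmult_indicator ennreal_mult')
    also have "\<dots> \<le> (\<integral>\<^sup>+p. (\<Sum>c\<in>I. \<integral>\<^sup>+l. ennreal (inc_ker (S c l) (N c l) (t n) p) \<partial>M) \<partial>lborel)"
      by (intro nn_integral_mono) (auto simp: indicator_def intro: pw)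
    also have "\<dots> = (\<Sum>c\<in>I. \<integral>\<^sup>+p. \<integral>\<^sup>+l. ennreal (inc_ker (S c l) (N c l) (t n) p) \<partial>M \<partial>lborel)"
      by (intro nn_integral_sum kmp)
    also have "\<dots> = (\<Sum>c\<in>I. \<integral>\<^sup>+l. ennreal (inc (S c l) (N c l) (t n)) \<partial>M)"
      by (intro sum.cong refl) (simp only: ki incn)
    also have "\<dots> = (\<Sum>c\<in>I. ennreal (\<integral>l. inc (S c l) (N c l) (t n) \<partial>M))"
    proof (intro sum.cong refl nn_integral_eq_integral)
      fix c assume c: "c \<in> I"
      show "integrable M (\<lambda>l. inc (S c l) (N c l) (t n))"
        using bounded_sets.inc_bounded[OF bs[OF c]] bounded_sets.inc_nonneg[OF bs[OF c]] incm[OF c]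
        by (intro integrable_const_bound[where B = "measure lborel (cball (0 :: (complex \<times> complex) \<times> pt) (2 * 5))"]) auto
      show "AE l in M. 0 \<le> inc (S c l) (N c l) (t n)"
        using bounded_sets.inc_nonneg[OF bs[OF c]] by auto
    qed
    also have "\<dots> = ennreal (\<Sum>c\<in>I. \<integral>l. inc (S c l) (N c l) (t n) \<partial>M)"
      using bounded_sets.inc_nonneg[OF bs] by (intro sum_ennreal integral_nonneg_AE) auto
    finally show ?thesis
      using bounded_sets.inc_nonneg[OF bs] by (subst (asm) ennreal_le_iff) (auto intro!: sum_nonneg integral_nonneg_AE)
  qed
  have "(\<lambda>n. \<Sum>c\<in>I. \<integral>l. inc (S c l) (N c l) (t n) / (norm (t n))\<^sup>2 \<partial>M) \<longlonglongrightarrow> (\<Sum>c\<in>I. 0)"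
    by (intro tendsto_sum) (use lim in simp)
  moreover have "\<kappa> * measure lborel P \<le> (\<Sum>c\<in>I. \<integral>l. inc (S c l) (N c l) (t n) / (norm (t n))\<^sup>2 \<partial>M)" for n
  proof -
    have "\<kappa> * measure lborel P = (\<kappa> * (norm (t n))\<^sup>2 * measure lborel P) / (norm (t n))\<^sup>2"
      using t(2) by simp
    also have "\<dots> \<le> (\<Sum>c\<in>I. \<integral>l. inc (S c l) (N c l) (t n) \<partial>M) / (norm (t n))\<^sup>2"
      using main by (rule divide_right_mono) simp
    finally show ?thesis by (simp add: sum_divide_distrib)
  qed
  ultimately have "\<kappa> * measure lborel P \<le> (\<Sum>c\<in>I. 0)"
    by (intro LIMSEQ_le_const) auto
  then show False
    using mult_pos_pos[OF \<kappa> P0'] by simp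
qed

section \<open>Two-outcome measurements on the ququart state\<close>

lemma norm_vec_squared: "(norm v)\<^sup>2 = (\<Sum>i\<in>UNIV. (cmod (v $ i))\<^sup>2)" for v :: "complex ^ 'n"
  by (simp add: norm_vec_def L2_set_def sum_nonneg)

text \<open>Dividing by the squared norm allows unnormalised vectors with the parameters themselves
  as entries.\<close>

definition projector :: "complex ^ 'n \<Rightarrow> complex ^ 'n ^ 'n" where
  "projector \<psi> = (\<chi> i j. \<psi> $ i * cnj (\<psi> $ j) / of_real ((norm \<psi>)\<^sup>2))"

text \<open>The restricted abstraction gives the value \<open>undefined\<close> off
  \<open>{1..2}\<close>, as membership in \<open>povms 2\<close> demands.\<close>

definition two_outcome :: "complex ^ 'n ^ 'n \<Rightarrow> nat \<Rightarrow> complex ^ 'n ^ 'n" where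
  "two_outcome A = (\<lambda>b\<in>{1..2}. if b = 1 then A else mat 1 - A)"

lemma quadratic_form_projector:
  "(\<Sum>i\<in>UNIV. cnj (v $ i) * (projector \<psi> *v v) $ i) =
     of_real ((cmod (\<Sum>i\<in>UNIV. cnj (v $ i) * \<psi> $ i))\<^sup>2 / (norm \<psi>)\<^sup>2)"
proof -
  have "(\<Sum>i\<in>UNIV. cnj (v $ i) * (projector \<psi> *v v) $ i) =
      (\<Sum>i\<in>UNIV. cnj (v $ i) * \<psi> $ i) * cnj (\<Sum>i\<in>UNIV. cnj (v $ i) * \<psi> $ i) / of_real ((norm \<psi>)\<^sup>2)"
    unfolding cnj_sum sum_product
    by (simp add: projector_def matrix_vector_mult_def sum_distrib_left sum_divide_distrib mult_ac)
  then show ?thesis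
    by (simp only: complex_norm_square[symmetric] of_real_divide)
qed

lemma hermitian_projector: "hermitian (projector \<psi>)"
  by (simp add: hermitian_def cadjoint_def projector_def vec_eq_iff mult.commute)

lemma cmod_inner_vec_le: "cmod (\<Sum>i\<in>UNIV. cnj (v $ i) * \<psi> $ i) \<le> norm v * norm \<psi>" for v \<psi> :: "complex ^ 'n"
proof -
  have "cmod (\<Sum>i\<in>UNIV. cnj (v $ i) * \<psi> $ i) \<le> (\<Sum>i\<in>UNIV. \<bar>norm (v $ i)\<bar> * \<bar>norm (\<psi> $ i)\<bar>)"
    by (intro sum_norm_le) (simp add: norm_mult)
  also have "\<dots> \<le> norm v * norm \<psi>"
    unfolding norm_vec_def by (rule L2_set_mult_ineq)
  finally show ?thesis .
qed

lemma psd_projector: "psd (projector \<psi>)"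
  unfolding psd_def quadratic_form_projector by (simp add: hermitian_projector)

text \<open>Positivity is the Cauchy-Schwarz inequality \<open>cmod_inner_vec_le\<close>.\<close>

lemma psd_compl_projector:
  fixes \<psi> :: "complex ^ 'n"
  assumes "\<psi> \<noteq> 0"
  shows "psd (mat 1 - projector \<psi>)"
  unfolding psd_def
proof (intro conjI allI)
  show "hermitian (mat 1 - projector \<psi>)"
    using hermitian_projector[of \<psi>]
    by (simp add: hermitian_def cadjoint_def vec_eq_iff mat_def)
  fix v :: "complex ^ 'n"
  have "(\<Sum>i\<in>UNIV. cnj (v $ i) * v $ i) = complex_of_real ((norm v)\<^sup>2)"
    unfolding norm_vec_squared of_real_sum by (intro sum.cong refl) (simp only: complex_norm_square mult.commute)
  then have "(\<Sum>i\<in>UNIV. cnj (v $ i) * ((mat 1 - projector \<psi>) *v v) $ i)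
     = of_real ((norm v)\<^sup>2 - (cmod (\<Sum>i\<in>UNIV. cnj (v $ i) * \<psi> $ i))\<^sup>2 / (norm \<psi>)\<^sup>2)"
    by (simp only: matrix_vector_mult_diff_rdistrib matrix_vector_mul_lid vector_minus_component right_diff_distrib
      sum_subtractf quadratic_form_projector of_real_diff)
  moreover have "(cmod (\<Sum>i\<in>UNIV. cnj (v $ i) * \<psi> $ i))\<^sup>2 \<le> (norm v)\<^sup>2 * (norm \<psi>)\<^sup>2"
    using power_mono[OF cmod_inner_vec_le[of v \<psi>], of 2] by (simp add: power_mult_distrib)
  ultimately show "0 \<le> Re (\<Sum>i\<in>UNIV. cnj (v $ i) * ((mat 1 - projector \<psi>) *v v) $ i)"
    using assms by (simp add: divide_le_eq)
qed

lemma two_outcome_povm: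
  assumes "psd A" "psd (mat 1 - A)"
  shows "two_outcome A \<in> povms 2"
proof -
  have "{1..2::nat} = {1, 2}" by auto
  then show ?thesis using assms by (auto simp: povms_def two_outcome_def)
qed

section \<open>The Born rule for the maximally entangled state\<close>

lemma sum_diagonal:
  fixes h :: "'n::finite \<times> 'n \<Rightarrow> 'b::comm_monoid_add"
  shows "(\<Sum>p\<in>UNIV. if fst p = snd p then h p else 0) = (\<Sum>i\<in>UNIV. h (i, i))"
proof -
  have "(\<Sum>p\<in>UNIV. if fst p = snd p then h p else 0) = (\<Sum>i\<in>UNIV. \<Sum>k\<in>UNIV. if i = k then h (i, k) else 0)"
    unfolding UNIV_Times_UNIV[symmetric] sum.cartesian_product by (simp only: case_prod_unfold prod.collapse)
  then show ?thesis by simp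
qed

text \<open>The right side is a quarter of the trace of \<open>A\<close> times the transpose of
  \<open>B\<close>. Hence two rank-one projectors meet through a dot product without
  conjugation.\<close>

lemma trace_Phi4:
  "trace (pure_state Phi4 ** tensor_mat A B) = (\<Sum>i\<in>UNIV. \<Sum>j\<in>UNIV. A $ i $ j * B $ i $ j) / 4"
proof -
  have "trace (pure_state Phi4 ** tensor_mat A B)
      = (\<Sum>p\<in>UNIV. \<Sum>q\<in>UNIV. pure_state Phi4 $ p $ q * tensor_mat A B $ q $ p)"
    by (simp add: trace_def matrix_matrix_mult_def)
  also have "\<dots> = (\<Sum>p\<in>UNIV. if fst p = snd p then (\<Sum>q\<in>UNIV. if fst q = snd q then A $ fst q $ fst p * B $ snd q $ snd p / 4 else 0) else 0)"
    by (intro sum.cong refl) (auto simp: pure_state_def Phi4_nth tensor_mat_def intro!: sum.cong)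
  also have "\<dots> = (\<Sum>i\<in>UNIV. \<Sum>j\<in>UNIV. A $ j $ i * B $ j $ i / 4)"
    by (simp add: sum_diagonal)
  also have "\<dots> = (\<Sum>i\<in>UNIV. \<Sum>j\<in>UNIV. A $ i $ j * B $ i $ j) / 4"
    by (subst sum.swap) (simp add: sum_divide_distrib)
  finally show ?thesis .
qed

lemma trace_Phi4_projectors:
  "trace (pure_state Phi4 ** tensor_mat (projector \<psi>) (projector \<phi>))
    = of_real ((cmod (\<Sum>i\<in>UNIV. \<psi> $ i * \<phi> $ i))\<^sup>2 / (4 * (norm \<psi>)\<^sup>2 * (norm \<phi>)\<^sup>2))"
proof -
  have "trace (pure_state Phi4 ** tensor_mat (projector \<psi>) (projector \<phi>))
    = (\<Sum>i\<in>UNIV. \<psi> $ i * \<phi> $ i) * cnj (\<Sum>i\<in>UNIV. \<psi> $ i * \<phi> $ i) / of_real (4 * (norm \<psi>)\<^sup>2 * (norm \<phi>)\<^sup>2)"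
    unfolding trace_Phi4 cnj_sum sum_product
    by (simp add: projector_def sum_divide_distrib mult_ac)
  then show ?thesis by (simp only: complex_norm_square[symmetric] of_real_divide)
qed

text \<open>The last case is the index 0 of the type \<open>4\<close>. Setting entry 2 to 1 here and
  entry 1 to 1 in \<open>bob_vec\<close> makes \<open>fst x\<close> and \<open>fst y\<close> enter
  the dot product additively; dimension four leaves two bilinear terms.\<close>

definition alice_vec :: "pt \<Rightarrow> complex ^ 4" where
  "alice_vec x = (\<chi> i. if i = 1 then fst x else if i = 2 then 1 else if i = 3 then fst (snd x) else snd (snd x))"

definition bob_vec :: "pt \<Rightarrow> complex ^ 4" where
  "bob_vec y = (\<chi> i. if i = 1 then 1 else if i = 2 then fst y else if i = 3 then fst (snd y) else snd (snd y))"

lemma sum_alice_bob: "(\<Sum>i\<in>UNIV. alice_vec x $ i * bob_vec y $ i) = pairing x y"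
  by (simp add: sum_4 alice_vec_def bob_vec_def pairing_def bil_def mult.commute)

lemma norm_alice_vec: "(norm (alice_vec x))\<^sup>2 = 1 + (norm x)\<^sup>2"
  by (cases x) (auto simp add: norm_vec_squared sum_4 alice_vec_def norm_prod_def)

lemma norm_bob_vec: "(norm (bob_vec x))\<^sup>2 = 1 + (norm x)\<^sup>2"
  by (cases x) (auto simp add: norm_vec_squared sum_4 bob_vec_def norm_prod_def)

lemma alice_vec_nonzero: "alice_vec x \<noteq> 0" and bob_vec_nonzero: "bob_vec x \<noteq> 0"
  using norm_alice_vec[of x] norm_bob_vec[of x] by (auto simp: add_nonneg_eq_0_iff)

lemma continuous_alice_vec: "continuous_on UNIV alice_vec"
  and continuous_bob_vec: "continuous_on UNIV bob_vec"
proof -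
  have "continuous_on UNIV (\<lambda>x::pt. if i = 1 then fst x else if i = 2 then 1 else if i = 3 then fst (snd x) else snd (snd x))"
    "continuous_on UNIV (\<lambda>x::pt. if i = 1 then 1 else if i = 2 then fst x else if i = 3 then fst (snd x) else snd (snd x))" for i :: 4
    by (cases "i = 1"; cases "i = 2"; cases "i = 3"; simp add: continuous_intros)+
  then show "continuous_on UNIV alice_vec" "continuous_on UNIV bob_vec"
    unfolding alice_vec_def bob_vec_def by (auto intro: continuous_on_vec_lambda)
qed

text \<open>A map into the product topology is continuous if its components are; \<open>nz\<close>
  keeps the denominator in \<open>projector\<close> away from 0 and makes the complement
  positive.\<close>

lemma two_outcome_projector_measurable:
  fixes \<psi> :: "pt \<Rightarrow> complex ^ 'n"
  assumes c: "continuous_on UNIV \<psi>" and nz: "\<And>x. \<psi> x \<noteq> 0"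
  shows "(\<lambda>x. two_outcome (projector (\<psi> x))) \<in> borel \<rightarrow>\<^sub>M povm_borel 2"
proof -
  have p: "continuous_on UNIV (\<lambda>x. projector (\<psi> x))"
    unfolding projector_def using c nz
    by (intro continuous_on_vec_lambda continuous_intros) auto
  have "continuous_on UNIV (\<lambda>x. two_outcome (projector (\<psi> x)))"
  proof (rule continuous_on_coordinatewise_then_product)
    fix b :: nat
    show "continuous_on UNIV (\<lambda>x. two_outcome (projector (\<psi> x)) b)"
      by (cases "b \<in> {1..2}"; cases "b = 1") (auto simp: two_outcome_def restrict_def intro!: continuous_intros p)
  qed
  then show ?thesis
    unfolding povm_borel_def
    by (intro measurable_restrict_space2 borel_measurable_continuous_onI)
      (auto intro!: two_outcome_povm psd_projector psd_compl_projector nz)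
qed

theorem corollaryC3:
  fixes dC :: nat
  shows "\<not> admits_classical_simulation TYPE('l) dC (pure_state Phi4)"
proof
  assume "admits_classical_simulation TYPE('l) dC (pure_state Phi4)"
  then obtain \<mu> :: "'l measure" and pA pB where sim: "classical_simulation dC (pure_state Phi4) \<mu> pA pB"
    unfolding admits_classical_simulation_def by blast
  define MA where "MA x = two_outcome (projector (alice_vec x))" for x
  define MB where "MB y = two_outcome (projector (bob_vec y))" for y
  have MA: "MA x \<in> povms 2" and MB: "MB x \<in> povms 2" for x
    unfolding MA_def MB_def
    by (intro two_outcome_povm psd_projector psd_compl_projector alice_vec_nonzero bob_vec_nonzero)+
  have MAm: "MA \<in> borel \<rightarrow>\<^sub>M povm_borel 2" and MBm: "MB \<in> borel \<rightarrow>\<^sub>M povm_borel 2"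
    unfolding MA_def MB_def
    by (intro two_outcome_projector_measurable continuous_alice_vec continuous_bob_vec alice_vec_nonzero bob_vec_nonzero)+
  define f where "f c x l = pA 2 1 c (MA x) l" for c x l
  define g where "g c y l = pB 2 1 (MB y) c l" for c y l
  note sim = sim[unfolded classical_simulation_def]
  have prob: "prob_space \<mu>" using sim by (rule conjunct1)
  have pA: "(\<forall>a\<in>{1..2}. \<forall>c\<in>{1..dC}. 0 \<le> pA 2 a c (MA x) l) \<and> (\<Sum>a=1..2. \<Sum>c=1..dC. pA 2 a c (MA x) l) = 1"
    if "l \<in> space \<mu>" for x l
    using sim[THEN conjunct2, THEN conjunct1, rule_format, of 2, OF _ MA that] by simp
  have pB: "(\<forall>b\<in>{1..2}. 0 \<le> pB 2 b (MB y) c l) \<and> (\<Sum>b=1..2. pB 2 b (MB y) c l) = 1"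
    if "l \<in> space \<mu>" "c \<in> {1..dC}" for y l c
    using sim[THEN conjunct2, THEN conjunct2, THEN conjunct1, rule_format, of 2, OF _ MB that(2,1)] by simp
  have pAm: "(\<lambda>(M, l). pA 2 1 c M l) \<in> borel_measurable (povm_borel 2 \<Otimes>\<^sub>M \<mu>)" if "c \<in> {1..dC}" for c
    using sim[THEN conjunct2, THEN conjunct2, THEN conjunct2, THEN conjunct1, rule_format, of 2 1 c] that by simp
  have pBm: "(\<lambda>(M, l). pB 2 1 M c l) \<in> borel_measurable (povm_borel 2 \<Otimes>\<^sub>M \<mu>)" if "c \<in> {1..dC}" for c
    using sim[THEN conjunct2, THEN conjunct2, THEN conjunct2, THEN conjunct2, THEN conjunct1, rule_format, of 2 1 c] that by simp
  have "trace (pure_state Phi4 ** tensor_mat (MA x 1) (MB y 1)) =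
      complex_of_real (\<integral>l. (\<Sum>c=1..dC. f c x l * g c y l) \<partial>\<mu>)" for x y
    unfolding f_def g_def
    using sim[THEN conjunct2, THEN conjunct2, THEN conjunct2, THEN conjunct2, THEN conjunct2, rule_format, of 2 2 "MA x" "MB y" 1 1] MA MB by simp
  \<comment> \<open>The factor 4 comes from the state, the other two are the squared norms of
    \<open>alice_vec x\<close> and \<open>bob_vec y\<close>.\<close>
  then have born: "(\<integral>l. (\<Sum>c\<in>{1..dC}. f c x l * g c y l) \<partial>\<mu>)
      = (cmod (pairing x y))\<^sup>2 / (4 * (1 + (norm x)\<^sup>2) * (1 + (norm y)\<^sup>2))" for x y
    unfolding MA_def MB_def
    by (simp add: two_outcome_def trace_Phi4_projectors sum_alice_bob norm_alice_vec norm_bob_vec del: of_real_divide of_real_power of_real_mult of_real_add)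
  show False
  \<comment> \<open>On the balls of radius 5 and 1 the denominator in \<open>born\<close> is at most
    \<open>4 * (1 + 25) * (1 + 1) = 208\<close>.\<close>
  proof (rule no_bounded_nonneg_factorization[OF prob, of "{1..dC}" "1/208" f g])
    fix c assume c: "c \<in> {1..dC}"
    have m: "(\<lambda>q. (K (fst q), snd q)) \<in> borel \<Otimes>\<^sub>M \<mu> \<rightarrow>\<^sub>M povm_borel 2 \<Otimes>\<^sub>M \<mu>"
      if "K \<in> borel \<rightarrow>\<^sub>M povm_borel 2" for K :: "pt \<Rightarrow> nat \<Rightarrow> complex ^ 4 ^ 4"
      using that by measurable
    show "(\<lambda>(x, l). f c x l) \<in> borel_measurable (borel \<Otimes>\<^sub>M \<mu>)"
      using measurable_compose[OF m[OF MAm] pAm[OF c]] by (simp add: f_def case_prod_unfold)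
    show "(\<lambda>(y, l). g c y l) \<in> borel_measurable (borel \<Otimes>\<^sub>M \<mu>)"
      using measurable_compose[OF m[OF MBm] pBm[OF c]] by (simp add: g_def case_prod_unfold)
    fix x :: pt and l assume l: "l \<in> space \<mu>"
    show "0 \<le> f c x l \<and> f c x l \<le> 1"
    proof
      show "0 \<le> f c x l" using pA[OF l] c by (simp add: f_def)
      have "pA 2 1 c (MA x) l \<le> (\<Sum>c=1..dC. pA 2 1 c (MA x) l)"
        using pA[OF l] c by (intro member_le_sum) auto
      also have "\<dots> \<le> (\<Sum>a=1..2. \<Sum>c=1..dC. pA 2 a c (MA x) l)"
        using pA[OF l] by (intro member_le_sum[of 1 "{1..2}" "\<lambda>a. \<Sum>c=1..dC. pA 2 a c (MA x) l"] sum_nonneg) auto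
      finally show "f c x l \<le> 1" using pA[OF l] by (simp add: f_def)
    qed
    show "0 \<le> g c x l \<and> g c x l \<le> 1"
    proof
      show "0 \<le> g c x l" using pB[OF l c] by (simp add: g_def)
      have "pB 2 1 (MB x) c l \<le> (\<Sum>b=1..2. pB 2 b (MB x) c l)"
        using pB[OF l c] by (intro member_le_sum) auto
      then show "g c x l \<le> 1" using pB[OF l c] by (simp add: g_def)
    qed
  next
    fix x y :: pt assume "pairing x y = 0"
    then show "(\<integral>l. (\<Sum>c\<in>{1..dC}. f c x l * g c y l) \<partial>\<mu>) = 0" by (simp only: born) simp
  next
    fix x y :: pt assume n: "norm x \<le> 5" "norm y \<le> 1"
    have "4 * (1 + (norm x)\<^sup>2) * (1 + (norm y)\<^sup>2) \<le> 104 * 2"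
      using power_mono[OF n(1), of 2] power_mono[OF n(2), of 2] by (intro mult_mono) auto
    then have "(cmod (pairing x y))\<^sup>2 / 208 \<le> (cmod (pairing x y))\<^sup>2 / (4 * (1 + (norm x)\<^sup>2) * (1 + (norm y)\<^sup>2))"
      by (intro divide_left_mono mult_pos_pos add_pos_nonneg) simp_all
    then show "1 / 208 * (cmod (pairing x y))\<^sup>2 \<le> (\<integral>l. (\<Sum>c\<in>{1..dC}. f c x l * g c y l) \<partial>\<mu>)"
      by (simp only: born)
  qed simp_all
qed

end
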